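(* Let $\Gamma=(N,(C_i)_{i\in N},(U_i)_{i\in N})$ be a finite game. Let $c\in C$ be a pure strategy profile with probability zero in all correlated equilibria of $\Gamma$ (respectively, let $c_i\in C_i$ be a pure strategy with marginal probability zero in all correlated equilibria of $\Gamma$). Then $c$ (respectively, $c_i$) is eliminated in all full dual reductions of $\Gamma$ and in all elementary iterative dual reductions of $\Gamma$.
   Context: A finite game in strategic form is $\Gamma=(N,(C_i)_{i\in N},(U_i)_{i\in N})$, where $N$ is a finite nonempty set of players, $C_i$ is the finite nonempty set of pure strategies of player $i$, $C=\prod_{j\in N}C_j$, $C_{-i}=\prod_{j\ne i}C_j$, and $U_i:C\to\mathbb{R}$ is the utility function of player $i$, extended multilinearly to mixed strategies. A correlated equilibrium is $\mu\in\Delta(C)$ with $\sum_{c_{-i}\in C_{-i}}\mu(c)[U_i(c_{-i},d_i)-U_i(c)]\le 0$ for all $i\in N$, $c_i,d_i\in C_i$ (where $c=(c_{-i},c_i)$). It is strict if this inequality is strict for all $i$, all $c_i$ with positive marginal probability in $\mu$ and all $d_i\ne c_i$. A game is elementary if it has a strict correlated equilibrium with full support (i.e. $\mu(c)>0$ for all $c\in C$). A deviation plan for player $i$ is a map $\alpha_i:C_i\to\Delta(C_i)$; write $\alpha_i\ast c_i$ for the image of $c_i$, $\alpha_i(d_i|c_i)=(\alpha_i\ast c_i)(d_i)$, and $\alpha_i\ast\sigma_i=\sum_{c_i}\sigma_i(c_i)(\alpha_i\ast c_i)$ for $\sigma_i\in\Delta(C_i)$. A dual vector of $\Gamma$ is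 a profile of deviation plans $\alpha=(\alpha_i)_{i\in N}$ such that $\sum_{i\in N}[U_i(c_{-i},\alpha_i\ast c_i)-U_i(c)]\ge 0$ for every $c\in C$. It is full if $\alpha_i(d_i|c_i)>0$ whenever $\beta_i(d_i|c_i)>0$ for some dual vector $\beta$. A nonempty $B_i\subset C_i$ is $\alpha_i$-absorbing if $\alpha_i\ast c_i$ has support in $B_i$ for every $c_i\in B_i$, and minimal $\alpha_i$-absorbing if moreover it has no nonempty proper absorbing subset. For each minimal $\alpha_i$-absorbing set there is a unique $\alpha_i$-stationary mixed strategy ($\alpha_i\ast\sigma_i=\sigma_i$) supported in it; $C_i/\alpha_i\subset\Delta(C_i)$ is the set of these strategies, $C/\alpha=\prod_i C_i/\alpha_i$, and $\Gamma/\alpha$ is the game with player set $N$, pure strategy sets $C_i/\alpha_i$ and the same utility functions. A (full) dual reduction of $\Gamma$ is a game $\Gamma/\alpha$ with $\alpha$ a (full) dual vector. An iterative dual reduction of $\Gamma$ is a game $\Gamma/\alpha^1/\alpha^2/\cdots/\alpha^K$ where each $\alpha^k$ is a dual vector of $\Gamma/\alpha^1/\cdots/\alpha^{k-1}$; its pure strategies are identified, by composing mixtures, with mixed strategies of $\Gamma$. A pure strategy $c_i$ is eliminated in a (possibly iterative) dual reduction if $\sigma_i(c_i)=0$ for every pure strategy $\sigma_i$ of player $i$ in the reduced game; a pure strategy profile $c$ is eliminated if $\sigma(c)=\prod_i\sigma_i(c_i)=0$ for every pure strategy profile $\sigma$ of the reduced game. *)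

theory Defs
  imports "HOL-Probability.Probability"
begin

record ('i, 's) game =
  players :: "'i set"
  strats :: "'i \<Rightarrow> 's set"
  util :: "'i \<Rightarrow> ('i \<Rightarrow> 's) \<Rightarrow> real"

text \<open>Only the strategy sets of actual players, and the utilities at extensional profiles, carry
  information; the other values of the record fields are irrelevant.\<close>

definition finite_game :: "('i, 's) game \<Rightarrow> bool" where
  "finite_game \<Gamma> \<longleftrightarrow> finite (players \<Gamma>) \<and> players \<Gamma> \<noteq> {} \<and>
     (\<forall>i\<in>players \<Gamma>. finite (strats \<Gamma> i) \<and> strats \<Gamma> i \<noteq> {})"

definition profiles :: "('i, 's) game \<Rightarrow> ('i \<Rightarrow> 's) set" where
  "profiles \<Gamma> = PiE (players \<Gamma>) (strats \<Gamma>)"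

definition mixed_util :: "('i, 's) game \<Rightarrow> 'i \<Rightarrow> ('i \<Rightarrow> 's pmf) \<Rightarrow> real" where
  "mixed_util \<Gamma> i \<sigma> = (\<Sum>c\<in>profiles \<Gamma>. (\<Prod>j\<in>players \<Gamma>. pmf (\<sigma> j) (c j)) * util \<Gamma> i c)"

definition correlated_equilibrium :: "('i, 's) game \<Rightarrow> ('i \<Rightarrow> 's) pmf \<Rightarrow> bool" where
  "correlated_equilibrium \<Gamma> \<mu> \<longleftrightarrow> set_pmf \<mu> \<subseteq> profiles \<Gamma> \<and>
     (\<forall>i\<in>players \<Gamma>. \<forall>c\<^sub>i\<in>strats \<Gamma> i. \<forall>d\<^sub>i\<in>strats \<Gamma> i.
        (\<Sum>c | c \<in> profiles \<Gamma> \<and> c i = c\<^sub>i. pmf \<mu> c * (util \<Gamma> i (c(i := d\<^sub>i)) - util \<Gamma> i c)) \<le> 0)"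

definition marginal :: "('i \<Rightarrow> 's) pmf \<Rightarrow> 'i \<Rightarrow> 's pmf" where
  "marginal \<mu> i = map_pmf (\<lambda>c. c i) \<mu>"

definition strict_correlated_equilibrium :: "('i, 's) game \<Rightarrow> ('i \<Rightarrow> 's) pmf \<Rightarrow> bool" where
  "strict_correlated_equilibrium \<Gamma> \<mu> \<longleftrightarrow> correlated_equilibrium \<Gamma> \<mu> \<and>
     (\<forall>i\<in>players \<Gamma>. \<forall>c\<^sub>i\<in>strats \<Gamma> i. \<forall>d\<^sub>i\<in>strats \<Gamma> i.
        pmf (marginal \<mu> i) c\<^sub>i > 0 \<longrightarrow> d\<^sub>i \<noteq> c\<^sub>i \<longrightarrow>
        (\<Sum>c | c \<in> profiles \<Gamma> \<and> c i = c\<^sub>i. pmf \<mu> c * (util \<Gamma> i (c(i := d\<^sub>i)) - util \<Gamma> i c)) < 0)"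

definition elementary :: "('i, 's) game \<Rightarrow> bool" where
  "elementary \<Gamma> \<longleftrightarrow>
     (\<exists>\<mu>. strict_correlated_equilibrium \<Gamma> \<mu> \<and> (\<forall>c\<in>profiles \<Gamma>. pmf \<mu> c > 0))"

text \<open>The paper's \<open>\<alpha>\<^sub>i \<ast> c\<^sub>i\<close> is \<open>a c\<^sub>i\<close>, \<open>\<alpha>\<^sub>i(d\<^sub>i|c\<^sub>i)\<close> is \<open>pmf (a c\<^sub>i) d\<^sub>i\<close> and
  \<open>\<alpha>\<^sub>i \<ast> \<sigma>\<^sub>i\<close> is \<open>bind_pmf \<sigma>\<^sub>i a\<close>, where \<open>a\<close> is player \<open>i\<close>'s deviation plan.\<close>

definition deviation_plan :: "'s set \<Rightarrow> ('s \<Rightarrow> 's pmf) \<Rightarrow> bool" where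
  "deviation_plan C a \<longleftrightarrow> (\<forall>c\<in>C. set_pmf (a c) \<subseteq> C)"

definition dual_vector :: "('i, 's) game \<Rightarrow> ('i \<Rightarrow> 's \<Rightarrow> 's pmf) \<Rightarrow> bool" where
  "dual_vector \<Gamma> \<alpha> \<longleftrightarrow> (\<forall>i\<in>players \<Gamma>. deviation_plan (strats \<Gamma> i) (\<alpha> i)) \<and>
     (\<forall>c\<in>profiles \<Gamma>.
        (\<Sum>i\<in>players \<Gamma>.
           mixed_util \<Gamma> i ((\<lambda>j. return_pmf (c j))(i := \<alpha> i (c i))) - util \<Gamma> i c) \<ge> 0)"

definition full_dual_vector :: "('i, 's) game \<Rightarrow> ('i \<Rightarrow> 's \<Rightarrow> 's pmf) \<Rightarrow> bool" where
  "full_dual_vector \<Gamma> \<alpha> \<longleftrightarrow> dual_vector \<Gamma> \<alpha> \<and>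
     (\<forall>\<beta>. dual_vector \<Gamma> \<beta> \<longrightarrow>
        (\<forall>i\<in>players \<Gamma>. \<forall>c\<^sub>i\<in>strats \<Gamma> i. \<forall>d\<^sub>i\<in>strats \<Gamma> i.
           pmf (\<beta> i c\<^sub>i) d\<^sub>i > 0 \<longrightarrow> pmf (\<alpha> i c\<^sub>i) d\<^sub>i > 0))"

definition absorbing :: "'s set \<Rightarrow> ('s \<Rightarrow> 's pmf) \<Rightarrow> 's set \<Rightarrow> bool" where
  "absorbing C a B \<longleftrightarrow> B \<noteq> {} \<and> B \<subseteq> C \<and> (\<forall>c\<in>B. set_pmf (a c) \<subseteq> B)"

definition minimal_absorbing :: "'s set \<Rightarrow> ('s \<Rightarrow> 's pmf) \<Rightarrow> 's set \<Rightarrow> bool" where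
  "minimal_absorbing C a B \<longleftrightarrow> absorbing C a B \<and> (\<forall>B'. B' \<subset> B \<longrightarrow> \<not> absorbing C a B')"

definition stationary :: "('s \<Rightarrow> 's pmf) \<Rightarrow> 's pmf \<Rightarrow> bool" where
  "stationary a \<sigma> \<longleftrightarrow> bind_pmf \<sigma> a = \<sigma>"

definition reduced_strats :: "'s set \<Rightarrow> ('s \<Rightarrow> 's pmf) \<Rightarrow> 's pmf set" where
  "reduced_strats C a = {\<sigma>. stationary a \<sigma> \<and> (\<exists>B. minimal_absorbing C a B \<and> set_pmf \<sigma> \<subseteq> B)}"

text \<open>The game in which the pure strategies are given sets of mixed strategies of \<open>\<Gamma>\<close>,
  with the same utility functions.\<close>

definition mixed_game :: "('i, 's) game \<Rightarrow> ('i \<Rightarrow> 's pmf set) \<Rightarrow> ('i, 's pmf) game" where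
  "mixed_game \<Gamma> S = \<lparr>players = players \<Gamma>, strats = S, util = mixed_util \<Gamma>\<rparr>"

definition dual_reduction ::
  "('i, 's) game \<Rightarrow> ('i \<Rightarrow> 's \<Rightarrow> 's pmf) \<Rightarrow> ('i, 's pmf) game" where
  "dual_reduction \<Gamma> \<alpha> = mixed_game \<Gamma> (\<lambda>i. reduced_strats (strats \<Gamma> i) (\<alpha> i))"

text \<open>A further reduction of a game \<open>G\<close>, whose pure strategies are mixed strategies of \<open>\<Gamma>\<close>, has as
  pure strategies mixtures of such; \<open>join_pmf\<close> composes them into mixed strategies of \<open>\<Gamma>\<close>.
  That this identification is faithful (injective, and compatible with the utilities) is shown in
  \<open>inj_on_join_pmf_iterative\<close> and \<open>mixed_util_mixed_game\<close> below.\<close>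

inductive iterative_dual_reduction :: "('i, 's) game \<Rightarrow> ('i, 's pmf) game \<Rightarrow> bool"
  for \<Gamma> :: "('i, 's) game" where
  single: "dual_vector \<Gamma> \<alpha> \<Longrightarrow> iterative_dual_reduction \<Gamma> (dual_reduction \<Gamma> \<alpha>)"
| step: "iterative_dual_reduction \<Gamma> G \<Longrightarrow> dual_vector G \<alpha> \<Longrightarrow>
    iterative_dual_reduction \<Gamma>
      (mixed_game \<Gamma> (\<lambda>i. join_pmf ` strats (dual_reduction G \<alpha>) i))"

definition strategy_eliminated :: "('i, 's pmf) game \<Rightarrow> 'i \<Rightarrow> 's \<Rightarrow> bool" where
  "strategy_eliminated G i c\<^sub>i \<longleftrightarrow> (\<forall>\<sigma>\<^sub>i\<in>strats G i. pmf \<sigma>\<^sub>i c\<^sub>i = 0)"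

definition profile_eliminated :: "('i, 's pmf) game \<Rightarrow> ('i \<Rightarrow> 's) \<Rightarrow> bool" where
  "profile_eliminated G c \<longleftrightarrow>
     (\<forall>\<sigma>\<in>profiles G. (\<Prod>i\<in>players G. pmf (\<sigma> i) (c i)) = 0)"

lemma pmf_bind_finite:
  assumes "finite A" "set_pmf p \<subseteq> A"
  shows "pmf (bind_pmf p f) x = (\<Sum>y\<in>A. pmf p y * pmf (f y) x)"
  unfolding pmf_bind using assms
  by (subst integral_measure_pmf[of A]) (auto simp: mult.commute)

lemma pmf_join_finite:
  assumes "finite A" "set_pmf p \<subseteq> A"
  shows "pmf (join_pmf p) x = (\<Sum>q\<in>A. pmf p q * pmf q x)"
  using pmf_bind_finite[OF assms, of "\<lambda>q. q"] by (simp add: join_eq_bind_pmf id_def)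

lemma mixed_util_mixed_game:
  assumes "finite (players \<Gamma>)" "\<And>j. j \<in> players \<Gamma> \<Longrightarrow> finite (S j)"
    and "\<And>j. j \<in> players \<Gamma> \<Longrightarrow> set_pmf (\<tau> j) \<subseteq> S j"
  shows "mixed_util (mixed_game \<Gamma> S) i \<tau> = mixed_util \<Gamma> i (\<lambda>j. join_pmf (\<tau> j))"
proof -
  have "mixed_util (mixed_game \<Gamma> S) i \<tau> =
      (\<Sum>\<sigma>\<in>PiE (players \<Gamma>) S. \<Sum>c\<in>profiles \<Gamma>.
        (\<Prod>j\<in>players \<Gamma>. pmf (\<tau> j) (\<sigma> j) * pmf (\<sigma> j) (c j)) * util \<Gamma> i c)"
    by (simp add: mixed_util_def mixed_game_def profiles_def prod.distrib sum_distrib_left mult.assoc)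
  also have "\<dots> = (\<Sum>c\<in>profiles \<Gamma>. \<Sum>\<sigma>\<in>PiE (players \<Gamma>) S.
        (\<Prod>j\<in>players \<Gamma>. pmf (\<tau> j) (\<sigma> j) * pmf (\<sigma> j) (c j)) * util \<Gamma> i c)"
    by (rule sum.swap)
  also have "\<dots> = (\<Sum>c\<in>profiles \<Gamma>.
        (\<Prod>j\<in>players \<Gamma>. \<Sum>s\<in>S j. pmf (\<tau> j) s * pmf s (c j)) * util \<Gamma> i c)"
    using assms by (simp add: sum_distrib_right[symmetric] prod_sum_PiE)
  also have "\<dots> = mixed_util \<Gamma> i (\<lambda>j. join_pmf (\<tau> j))"
    unfolding mixed_util_def using assms(2,3)
    by (intro sum.cong prod.cong arg_cong2[where f = "(*)"] refl pmf_join_finite[symmetric])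
  finally show ?thesis .
qed

lemma minimal_absorbing_support:
  assumes "minimal_absorbing C a B" "stationary a p" "set_pmf p \<subseteq> B"
  shows "set_pmf p = B"
proof -
  have "(\<Union>c\<in>set_pmf p. set_pmf (a c)) = set_pmf p"
    using assms(2) unfolding stationary_def by (metis set_bind_pmf)
  then have "absorbing C a (set_pmf p)"
    using assms unfolding minimal_absorbing_def absorbing_def by (auto simp: set_pmf_not_empty)
  then show ?thesis using assms unfolding minimal_absorbing_def by blast
qed

lemma stationary_unique:
  assumes C: "finite C" and B: "minimal_absorbing C a B"
    and p: "stationary a p" "set_pmf p \<subseteq> B" and q: "stationary a q" "set_pmf q \<subseteq> B"
  shows "p = q"
proof -
  have sp: "set_pmf p = B" and sq: "set_pmf q = B"
    using minimal_absorbing_support[OF B p] minimal_absorbing_support[OF B q] .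
  have fin: "finite B" "B \<noteq> {}"
    using B finite_subset[OF _ C, of B] unfolding minimal_absorbing_def absorbing_def by blast+
  define t where "t = Min ((\<lambda>x. pmf p x / pmf q x) ` B)"
  define r where "r x = pmf p x - t * pmf q x" for x
  have qpos: "pmf q x > 0" if "x \<in> B" for x using that sq by (simp add: pmf_positive)
  have r0: "r x \<ge> 0" if "x \<in> B" for x
  proof -
    have "t \<le> pmf p x / pmf q x" unfolding t_def using fin that by (intro Min_le) auto
    then show ?thesis using qpos[OF that] by (simp add: r_def field_simps)
  qed
  obtain x0 where x0: "x0 \<in> B" "t = pmf p x0 / pmf q x0"
    using Min_in[of "(\<lambda>x. pmf p x / pmf q x) ` B"] fin unfolding t_def by blast
  have rx0: "r x0 = 0" using x0 qpos[of x0] by (simp add: r_def)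
  have stat: "r x = (\<Sum>y\<in>B. r y * pmf (a y) x)" for x
  proof -
    have "pmf p x = (\<Sum>y\<in>B. pmf p y * pmf (a y) x)"
      using pmf_bind_finite[of B p a x] fin sp p(1) by (simp add: stationary_def)
    moreover have "pmf q x = (\<Sum>y\<in>B. pmf q y * pmf (a y) x)"
      using pmf_bind_finite[of B q a x] fin sq q(1) by (simp add: stationary_def)
    ultimately show ?thesis unfolding r_def
      by (simp add: left_diff_distrib sum_subtractf sum_distrib_left mult.assoc)
  qed
  define D where "D = {x\<in>B. r x > 0}"
  have Dclosed: "set_pmf (a y) \<subseteq> D" if "y \<in> D" for y
  proof
    fix x assume x: "x \<in> set_pmf (a y)"
    have "x \<in> B" using x that B unfolding D_def minimal_absorbing_def absorbing_def by auto
    moreover have "0 < r y * pmf (a y) x" using x that by (simp add: D_def pmf_positive)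
    moreover have "r y * pmf (a y) x \<le> r x"
      unfolding stat[of x] using that fin r0
      by (intro member_le_sum[where f = "\<lambda>y. r y * pmf (a y) x"]) (auto simp: D_def)
    ultimately show "x \<in> D" by (simp add: D_def)
  qed
  have "D \<subseteq> B" "x0 \<notin> D" using rx0 by (auto simp: D_def)
  then have "D \<subset> B" using x0(1) by blast
  have "D = {}"
  proof (rule ccontr)
    assume "D \<noteq> {}"
    moreover have "D \<subseteq> C"
      using \<open>D \<subseteq> B\<close> B unfolding minimal_absorbing_def absorbing_def by auto
    ultimately have "absorbing C a D" using Dclosed unfolding absorbing_def by simp
    then show False using \<open>D \<subset> B\<close> B unfolding minimal_absorbing_def by simp
  qed
  have eq: "pmf p x = t * pmf q x" if "x \<in> B" for x
  proof -
    have "\<not> r x > 0" using that \<open>D = {}\<close> unfolding D_def by blast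
    then show ?thesis using r0[OF that] by (simp add: r_def)
  qed
  have "1 = sum (pmf p) B" using sp fin by (simp add: sum_pmf_eq_1)
  also have "\<dots> = t * sum (pmf q) B" using eq by (simp add: sum_distrib_left)
  also have "\<dots> = t" using sq fin by (simp add: sum_pmf_eq_1)
  finally have t: "t = 1" by simp
  show ?thesis
  proof (rule pmf_eqI)
    fix x show "pmf p x = pmf q x"
    proof (cases "x \<in> B")
      case True
      then show ?thesis using eq t by simp
    next
      case False
      then have "x \<notin> set_pmf p" "x \<notin> set_pmf q" using sp sq by simp_all
      then show ?thesis by (simp add: set_pmf_iff)
    qed
  qed
qed

definition disjoint_supports :: "'s pmf set \<Rightarrow> bool" where
  "disjoint_supports S \<longleftrightarrow> (\<forall>p\<in>S. \<forall>q\<in>S. p \<noteq> q \<longrightarrow> set_pmf p \<inter> set_pmf q = {})"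

lemma disjoint_supports_reduced_strats:
  assumes "finite C"
  shows "disjoint_supports (reduced_strats C a)"
  unfolding disjoint_supports_def
proof (intro ballI impI)
  fix p q assume pq: "p \<in> reduced_strats C a" "q \<in> reduced_strats C a" "p \<noteq> q"
  obtain A B where A: "minimal_absorbing C a A" "stationary a p" "set_pmf p \<subseteq> A"
    and B: "minimal_absorbing C a B" "stationary a q" "set_pmf q \<subseteq> B"
    using pq unfolding reduced_strats_def by auto
  have "A \<noteq> B" using stationary_unique[OF assms A] B pq(3) by auto
  have "A \<inter> B = {}"
  proof (rule ccontr)
    assume "A \<inter> B \<noteq> {}"
    then have "absorbing C a (A \<inter> B)"
      using A(1) B(1) unfolding minimal_absorbing_def absorbing_def by blast
    then have "\<not> A \<inter> B \<subset> A" "\<not> A \<inter> B \<subset> B"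
      using A(1) B(1) unfolding minimal_absorbing_def by auto
    then show False using \<open>A \<noteq> B\<close> by auto
  qed
  then show "set_pmf p \<inter> set_pmf q = {}" using A B by auto
qed

lemma inj_on_join_pmf:
  assumes "finite S" "disjoint_supports S"
  shows "inj_on join_pmf {\<tau>. set_pmf \<tau> \<subseteq> S}"
proof (rule inj_onI, clarify)
  fix \<tau> \<tau>' assume *: "set_pmf \<tau> \<subseteq> S" "set_pmf \<tau>' \<subseteq> S" "join_pmf \<tau> = join_pmf \<tau>'"
  have key: "pmf (join_pmf u) x = pmf u s * pmf s x"
    if "set_pmf u \<subseteq> S" "s \<in> S" "x \<in> set_pmf s" for u s x
  proof -
    have "pmf (join_pmf u) x = (\<Sum>q\<in>S. pmf u q * pmf q x)"
      using pmf_join_finite[OF assms(1) that(1)] .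
    also have "\<dots> = (\<Sum>q\<in>{s}. pmf u q * pmf q x)"
    proof (intro sum.mono_neutral_right ballI)
      fix q assume "q \<in> S - {s}"
      then have "x \<notin> set_pmf q"
        using that assms(2) unfolding disjoint_supports_def by blast
      then show "pmf u q * pmf q x = 0" by (simp add: set_pmf_iff)
    qed (use assms(1) that in auto)
    finally show ?thesis by simp
  qed
  show "\<tau> = \<tau>'"
  proof (rule pmf_eqI)
    fix s show "pmf \<tau> s = pmf \<tau>' s"
    proof (cases "s \<in> S")
      case True
      obtain x where x: "x \<in> set_pmf s" using set_pmf_not_empty[of s] by auto
      then show ?thesis using key[OF *(1) True x] key[OF *(2) True x] *(3)
        by (simp add: set_pmf_iff)
    next
      case False
      then have "s \<notin> set_pmf \<tau>" "s \<notin> set_pmf \<tau>'" using *(1,2) by auto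
      then show ?thesis by (simp add: set_pmf_iff)
    qed
  qed
qed

lemma disjoint_supports_join:
  assumes "disjoint_supports S" "disjoint_supports T" "\<And>\<tau>. \<tau> \<in> T \<Longrightarrow> set_pmf \<tau> \<subseteq> S"
  shows "disjoint_supports (join_pmf ` T)"
  unfolding disjoint_supports_def
proof (intro ballI impI, elim imageE, hypsubst)
  fix p q assume pq: "p \<in> T" "q \<in> T" "join_pmf p \<noteq> join_pmf q"
  have "p \<noteq> q" using pq(3) by auto
  then have disj: "set_pmf p \<inter> set_pmf q = {}"
    using assms(2) pq(1,2) unfolding disjoint_supports_def by simp
  have "set_pmf s \<inter> set_pmf s' = {}" if s: "s \<in> set_pmf p" "s' \<in> set_pmf q" for s s'
  proof -
    have "s \<in> S" "s' \<in> S" "s \<noteq> s'" using s disj assms(3) pq(1,2) by auto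
    then show ?thesis using assms(1) unfolding disjoint_supports_def by simp
  qed
  then show "set_pmf (join_pmf p) \<inter> set_pmf (join_pmf q) = {}"
    unfolding set_pmf_join_pmf by blast
qed

lemma finite_disjoint_supports:
  assumes "finite C" "disjoint_supports S" "\<And>s. s \<in> S \<Longrightarrow> set_pmf s \<subseteq> C"
  shows "finite S"
proof (rule inj_on_finite)
  show "inj_on set_pmf S"
  proof (rule inj_onI, rule ccontr)
    fix p q assume "p \<in> S" "q \<in> S" "set_pmf p = set_pmf q" "p \<noteq> q"
    then show False using assms(2) set_pmf_not_empty[of q] unfolding disjoint_supports_def by auto
  qed
  show "set_pmf ` S \<subseteq> Pow C" using assms(3) by auto
  show "finite (Pow C)" using assms(1) by simp
qed

lemma reduced_strats_support: "\<sigma> \<in> reduced_strats C a \<Longrightarrow> set_pmf \<sigma> \<subseteq> C"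
  unfolding reduced_strats_def minimal_absorbing_def absorbing_def by blast

lemma iterative_dual_reduction_strats:
  assumes "finite_game \<Gamma>" "iterative_dual_reduction \<Gamma> G" "i \<in> players \<Gamma>"
  shows "finite (strats G i) \<and> disjoint_supports (strats G i) \<and>
    (\<forall>\<sigma>\<in>strats G i. set_pmf \<sigma> \<subseteq> strats \<Gamma> i)"
  using assms(2)
proof induction
  case (single \<alpha>)
  have fin: "finite (strats \<Gamma> i)" using assms unfolding finite_game_def by blast
  show ?case
    unfolding dual_reduction_def mixed_game_def
    using finite_disjoint_supports[OF fin disjoint_supports_reduced_strats[OF fin], of "\<alpha> i"]
      disjoint_supports_reduced_strats[OF fin, of "\<alpha> i"]
      reduced_strats_support[of _ "strats \<Gamma> i" "\<alpha> i"]
    by simp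
next
  case (step G \<alpha>)
  let ?T = "reduced_strats (strats G i) (\<alpha> i)"
  have fin: "finite (strats G i)" and dG: "disjoint_supports (strats G i)" using step by auto
  have dT: "disjoint_supports ?T" using disjoint_supports_reduced_strats[OF fin] .
  have "finite ?T" using finite_disjoint_supports[OF fin dT reduced_strats_support] .
  moreover have "disjoint_supports (join_pmf ` ?T)"
    using disjoint_supports_join[OF dG dT reduced_strats_support] .
  moreover have "\<forall>\<sigma>\<in>join_pmf ` ?T. set_pmf \<sigma> \<subseteq> strats \<Gamma> i"
    using step.IH reduced_strats_support[of _ "strats G i" "\<alpha> i"] by auto
  ultimately show ?case unfolding dual_reduction_def mixed_game_def by simp
qed

lemma inj_on_join_pmf_iterative:
  assumes "finite_game \<Gamma>" "iterative_dual_reduction \<Gamma> G" "i \<in> players \<Gamma>"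
  shows "inj_on join_pmf {\<tau>. set_pmf \<tau> \<subseteq> strats G i}"
  using inj_on_join_pmf[of "strats G i"] iterative_dual_reduction_strats[OF assms] by simp

end

theory Submission
  imports Defs
begin

text \<open>The two kinds of reduction call for two different arguments, both about the deviation plans
  of a dual vector read as Markov chains on the pure strategies of each player.

  For full dual reductions, the idea is linear programming duality. A profile \<open>c\<close> that has
  probability zero in all correlated equilibria admits a dual vector whose total gain at \<open>c\<close> is
  strictly positive (\<open>ex_strict_dual_vector\<close>). Mixing it into a full dual vector \<open>\<alpha>\<close> does not
  change the minimal absorbing sets. Under a product of strategies stationary for the mixture its
  expected total gain vanishes, so its total gain is zero throughout the products of minimal
  absorbing sets, and \<open>c\<close> can lie in none of them (\<open>full_dual_reduction_eliminates\<close>).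

  For elementary iterative reductions, the idea is that a correlated equilibrium of a dual
  reduction remains one in the original game when the recommended mixed strategies are carried out
  independently (\<open>correlated_equilibrium_induced\<close>). Against stationary opponents, following the
  plan never hurts; so the best replies to a recommendation include a whole absorbing set, hence a
  strategy of the reduced game, and a recommendation that is optimal in the reduced game is
  optimal against all deviations. Iterating this (\<open>correlated_equilibrium_iterative\<close>), a
  full-support equilibrium of an elementary reduction yields an equilibrium of \<open>\<Gamma>\<close> that gives
  positive probability to every profile that is not eliminated.

  A pure strategy with marginal probability zero in all equilibria occurs only in profiles of
  probability zero, and a strategy is eliminated as soon as all profiles containing it are.

  Duality and the existence of stationary strategies both come from the same theorem of the
  alternative for finite systems of linear inequalities (\<open>farkas_nonneg\<close>).\<close>

section \<open>A theorem of the alternative\<close>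

text \<open>Farkas' lemma for \<open>- b\<close> and the cone generated by the rows of \<open>A\<close>. Rows are added one at a
  time: when the form \<open>y\<close> obtained for the old rows is positive on the new row \<open>s\<close>, every vector
  is moved along \<open>s\<close> into the kernel of that form, and the induction hypothesis is applied to the
  moved vectors. The old rows and \<open>b\<close> are moved by nonnegative multiples of \<open>s\<close>, so a conic
  relation between moved vectors is one between the original vectors.\<close>

lemma farkas_equality:
  fixes A :: "'x \<Rightarrow> 'k \<Rightarrow> real" and b :: "'k \<Rightarrow> real"
  assumes "finite X" "finite K"
  shows "(\<exists>m. (\<forall>x\<in>X. 0 \<le> m x) \<and> (\<forall>k\<in>K. b k + (\<Sum>x\<in>X. m x * A x k) = 0)) \<or>
    (\<exists>y. (\<forall>x\<in>X. (\<Sum>k\<in>K. A x k * y k) \<le> 0) \<and> (\<Sum>k\<in>K. b k * y k) < 0)"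
  using assms(1)
proof (induction X arbitrary: A b)
  case empty
  show ?case
  proof (cases "\<forall>k\<in>K. b k = 0")
    case False
    then obtain k where "k \<in> K" "b k \<noteq> 0" by blast
    then have "(\<Sum>k\<in>K. b k * b k) \<noteq> 0"
      using assms(2) by (subst sum_nonneg_eq_0_iff) auto
    moreover have "0 \<le> (\<Sum>k\<in>K. b k * b k)" by (intro sum_nonneg) simp
    ultimately have "0 < (\<Sum>k\<in>K. b k * b k)" by linarith
    then show ?thesis by (intro disjI2 exI[of _ "\<lambda>k. - b k"]) (simp add: sum_negf)
  qed auto
next
  case (insert s X)
  let ?dot = "\<lambda>v y. \<Sum>k\<in>K. v k * (y k :: real)"
  from insert.IH[of b A] consider
      m where "\<forall>x\<in>X. 0 \<le> m x" "\<forall>k\<in>K. b k + (\<Sum>x\<in>X. m x * A x k) = 0"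
    | y where "\<forall>x\<in>X. ?dot (A x) y \<le> 0" "?dot b y < 0" by blast
  then show ?case
  proof cases
    case 1
    have "(\<Sum>x\<in>insert s X. (m(s := 0)) x * A x k) = (\<Sum>x\<in>X. m x * A x k)" for k
      using insert.hyps by (auto intro!: sum.cong)
    then show ?thesis
      using 1 by (intro disjI1 exI[of _ "m(s := 0)"]) simp
  next
    case (2 y)
    show ?thesis
    proof (cases "?dot (A s) y \<le> 0")
      case True
      then show ?thesis using 2 by blast
    next
      case False
      then have t: "?dot (A s) y > 0" by simp
      define r where "r v = - ?dot v y / ?dot (A s) y" for v
      define A' where "A' x k = A x k + r (A x) * A s k" for x k
      define b' where "b' k = b k + r b * A s k" for k
      have r0: "\<forall>x\<in>X. 0 \<le> r (A x)" "0 \<le> r b"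
        using 2 t by (auto simp: r_def divide_le_0_iff)
      from insert.IH[of b' A'] consider
          m where "\<forall>x\<in>X. 0 \<le> m x" "\<forall>k\<in>K. b' k + (\<Sum>x\<in>X. m x * A' x k) = 0"
        | z where "\<forall>x\<in>X. ?dot (A' x) z \<le> 0" "?dot b' z < 0" by blast
      then show ?thesis
      proof cases
        case 1
        define c where "c = r b + (\<Sum>x\<in>X. m x * r (A x))"
        have "0 \<le> c" unfolding c_def using 1 r0 by (intro add_nonneg_nonneg sum_nonneg) auto
        moreover have "b k + (\<Sum>x\<in>insert s X. (m(s := c)) x * A x k) = 0" if "k \<in> K" for k
        proof -
          have "(\<Sum>x\<in>insert s X. (m(s := c)) x * A x k) = c * A s k + (\<Sum>x\<in>X. m x * A x k)"
            using insert.hyps by (auto simp: sum.insert intro!: sum.cong)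
          then have "b k + (\<Sum>x\<in>insert s X. (m(s := c)) x * A x k)
              = b' k + (\<Sum>x\<in>X. m x * A' x k)"
            by (simp add: c_def A'_def b'_def algebra_simps sum.distrib sum_distrib_left)
          then show ?thesis using 1 that by simp
        qed
        ultimately show ?thesis
          using 1 by (intro disjI1 exI[of _ "m(s := c)"]) auto
      next
        case (2 z)
        \<comment> \<open>Correcting \<open>z\<close> by a multiple of \<open>y\<close> makes it vanish on \<open>s\<close>; on any vector it then takes
          the value of \<open>z\<close> on the moved vector.\<close>
        define w where "w k = z k - ?dot (A s) z / ?dot (A s) y * y k" for k
        have w: "?dot v w = ?dot v z + r v * ?dot (A s) z" for v
          unfolding w_def r_def
          by (simp add: algebra_simps sum_subtractf sum_distrib_left sum_divide_distrib)
        have dist: "(\<Sum>k\<in>K. (v k + q * A s k) * z k) = ?dot v z + q * ?dot (A s) z" for v q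
          by (simp add: algebra_simps sum.distrib sum_distrib_left)
        have "?dot (A x) w = ?dot (A' x) z" for x
          unfolding w A'_def dist ..
        moreover have "?dot b w = ?dot b' z" unfolding w b'_def dist ..
        moreover have "?dot (A s) w = 0" unfolding w r_def using t by simp
        ultimately show ?thesis using 2 by (intro disjI2 exI[of _ w]) auto
      qed
    qed
  qed
qed

text \<open>The sign constraints on \<open>y\<close> and the slack in the inequalities for \<open>m\<close> are both expressed by
  adding the negated unit vectors to the rows. Singling out the row \<open>x0\<close> as the vector \<open>b\<close> gives
  it a weight of at least \<open>1\<close> in the first alternative, and strictness in the second.\<close>

lemma farkas_nonneg:
  fixes A :: "'x \<Rightarrow> 'k \<Rightarrow> real"
  assumes "finite X" "finite K" "x0 \<in> X"
  shows "(\<exists>m. (\<forall>x\<in>X. 0 \<le> m x) \<and> 0 < m x0 \<and> (\<forall>k\<in>K. 0 \<le> (\<Sum>x\<in>X. m x * A x k))) \<or>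
    (\<exists>y. (\<forall>k\<in>K. 0 \<le> y k) \<and> (\<forall>x\<in>X. (\<Sum>k\<in>K. A x k * y k) \<le> 0) \<and> (\<Sum>k\<in>K. A x0 k * y k) < 0)"
proof -
  define A' where "A' = case_sum A (\<lambda>j k. if k = j then - 1 else 0)"
  have sum_plus: "(\<Sum>z\<in>X <+> K. g z) = (\<Sum>x\<in>X. g (Inl x)) + (\<Sum>k\<in>K. g (Inr k))"
    for g :: "'x + 'k \<Rightarrow> real"
    using sum.Plus[OF assms(1,2), of g] by (simp add: comp_def)
  have unit: "(\<Sum>j\<in>K. m j * A' (Inr j) k) = - m k" if "k \<in> K" for k and m :: "'k \<Rightarrow> real"
  proof -
    have "(\<Sum>j\<in>K. m j * A' (Inr j) k) = (\<Sum>j\<in>K. if k = j then - m j else 0)"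
      by (rule sum.cong) (auto simp: A'_def)
    then show ?thesis using that assms(2) by simp
  qed
  have unit': "(\<Sum>k\<in>K. A' (Inr j) k * y k) = - y j" if "j \<in> K" for j and y :: "'k \<Rightarrow> real"
  proof -
    have "(\<Sum>k\<in>K. A' (Inr j) k * y k) = (\<Sum>k\<in>K. if k = j then - y k else 0)"
      by (rule sum.cong) (auto simp: A'_def)
    then show ?thesis using that assms(2) by simp
  qed
  have "finite (X <+> K)" using assms by simp
  from farkas_equality[OF this assms(2), of "A x0" A'] consider
      m where "\<forall>z\<in>X <+> K. 0 \<le> m z" "\<forall>k\<in>K. A x0 k + (\<Sum>z\<in>X <+> K. m z * A' z k) = 0"
    | y where "\<forall>z\<in>X <+> K. (\<Sum>k\<in>K. A' z k * y k) \<le> 0" "(\<Sum>k\<in>K. A x0 k * y k) < 0"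
    by (elim disjE exE conjE) simp_all
  then show ?thesis
  proof cases
    case 1
    define n where "n x = m (Inl x) + (if x = x0 then 1 else 0)" for x
    have "0 \<le> (\<Sum>x\<in>X. n x * A x k)" if k: "k \<in> K" for k
    proof -
      have "(\<Sum>x\<in>X. n x * A x k) = (\<Sum>x\<in>X. m (Inl x) * A x k) + A x0 k"
      proof -
        have "n x * A x k = m (Inl x) * A x k + (if x = x0 then A x k else 0)" for x
          by (simp add: n_def algebra_simps)
        then show ?thesis using assms by (simp add: sum.distrib)
      qed
      also have "\<dots> = m (Inr k)"
      proof -
        have "A x0 k + (\<Sum>z\<in>X <+> K. m z * A' z k) = 0" using 1(2) k by blast
        then have "A x0 k + ((\<Sum>x\<in>X. m (Inl x) * A x k) - m (Inr k)) = 0"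
          unfolding sum_plus unit[OF k, of "\<lambda>j. m (Inr j)"] by (simp add: A'_def)
        then show ?thesis by simp
      qed
      finally show ?thesis using 1(1) k by auto
    qed
    moreover have "\<forall>x\<in>X. 0 \<le> n x" using 1(1) by (auto simp: n_def InlI intro!: add_nonneg_nonneg)
    moreover have "0 < n x0"
      using 1(1) InlI[OF assms(3), of K] by (auto simp: n_def intro: add_nonneg_pos)
    ultimately show ?thesis by blast
  next
    case (2 y)
    have "0 \<le> y k" if "k \<in> K" for k
      using bspec[OF 2(1), of "Inr k"] unit'[OF that, of y] that by auto
    moreover have "(\<Sum>k\<in>K. A x k * y k) \<le> 0" if "x \<in> X" for x
      using bspec[OF 2(1), of "Inl x"] that by (auto simp: A'_def)
    ultimately show ?thesis using 2(2) by blast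
  qed
qed

section \<open>Stationary distributions\<close>

lemma ex_pmf_of_weights:
  fixes f :: "'a \<Rightarrow> real"
  assumes "finite C" "\<And>x. x \<in> C \<Longrightarrow> 0 \<le> f x" "sum f C = 1"
  shows "\<exists>p. set_pmf p \<subseteq> C \<and> (\<forall>x\<in>C. pmf p x = f x)"
proof -
  let ?g = "\<lambda>x. if x \<in> C then f x else 0"
  have "(\<integral>\<^sup>+x. ennreal (?g x) \<partial>count_space UNIV) = (\<Sum>x\<in>C. ennreal (?g x))"
    using assms(1) by (intro nn_integral_count_space') auto
  also have "\<dots> = 1" using assms by (simp add: sum_ennreal)
  finally have "pmf (embed_pmf ?g) x = ?g x" for x
    using assms(2) by (intro pmf_embed_pmf) auto
  then show ?thesis by (intro exI[of _ "embed_pmf ?g"]) (auto simp: set_pmf_iff split: if_splits)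
qed

lemma ex_minimal_absorbing:
  assumes "finite C" "absorbing C a A"
  shows "\<exists>B\<subseteq>A. minimal_absorbing C a B"
proof -
  have "finite A" using assms finite_subset unfolding absorbing_def by blast
  then show ?thesis using assms(2)
  proof (induction A rule: finite_psubset_induct)
    case (psubset A)
    show ?case
    proof (cases "minimal_absorbing C a A")
      case False
      then obtain B' where "B' \<subset> A" "absorbing C a B'"
        using psubset.prems unfolding minimal_absorbing_def by blast
      then show ?thesis using psubset.IH[of B'] by blast
    qed blast
  qed
qed

text \<open>The maximum principle for Markov chains: if \<open>f\<close> does not exceed its mean over the next step,
  then from a point where \<open>f\<close> is maximal only such points can be reached.\<close>

lemma argmax_absorbing:
  fixes f :: "'s \<Rightarrow> real"
  assumes B: "finite B" "absorbing C a B"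
    and sub: "\<And>x. x \<in> B \<Longrightarrow> f x \<le> (\<Sum>z\<in>B. pmf (a x) z * f z)"
  shows "absorbing C a {x \<in> B. \<forall>z\<in>B. f z \<le> f x}" (is "absorbing C a ?M")
  unfolding absorbing_def
proof (intro conjI ballI subsetI)
  have "B \<noteq> {}" using B unfolding absorbing_def by blast
  then have "Max (f ` B) \<in> f ` B" using B(1) by (intro Max_in) auto
  then obtain x where "x \<in> B" "f x = Max (f ` B)" by auto
  then have "x \<in> ?M" using B(1) by auto
  then show "?M \<noteq> {}" by blast
  show "x \<in> C" if "x \<in> ?M" for x using that B unfolding absorbing_def by auto
  fix x z assume x: "x \<in> ?M" and z: "z \<in> set_pmf (a x)"
  have sup: "set_pmf (a x) \<subseteq> B" using x B unfolding absorbing_def by auto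
  then have zB: "z \<in> B" using z by auto
  have "(\<Sum>z\<in>B. pmf (a x) z * (f x - f z)) = f x - (\<Sum>z\<in>B. pmf (a x) z * f z)"
    using sum_pmf_eq_1[OF B(1) sup]
    by (simp add: right_diff_distrib sum_subtractf flip: sum_distrib_right)
  then have "(\<Sum>z\<in>B. pmf (a x) z * (f x - f z)) \<le> 0" using sub[of x] x by auto
  moreover have "pmf (a x) z * (f x - f z) \<le> (\<Sum>z\<in>B. pmf (a x) z * (f x - f z))"
    using x zB B(1) by (intro member_le_sum) auto
  ultimately have "pmf (a x) z * (f x - f z) \<le> 0" by linarith
  moreover have "0 < pmf (a x) z" using z by (simp add: pmf_positive)
  ultimately have "f x \<le> f z" by (auto simp: mult_le_0_iff)
  then show "z \<in> ?M" using x zB by force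
qed

text \<open>A nonnegative vector \<open>m\<close> that does not decrease under the transition is invariant, because
  the total mass is preserved. If there is none, the theorem of the alternative yields a function
  \<open>y\<close> on \<open>B\<close> that dominates its mean over the next step, strictly at \<open>x0\<close>. But the points where
  such a \<open>y\<close> is minimal form an absorbing set, which by minimality of \<open>B\<close> is all of \<open>B\<close>; then \<open>y\<close>
  is constant, which excludes strictness.\<close>

lemma ex_stationary:
  assumes C: "finite C" and B: "minimal_absorbing C a B"
  shows "\<exists>p. stationary a p \<and> set_pmf p = B"
proof -
  have absB: "absorbing C a B" and finB: "finite B"
    using B finite_subset[OF _ C] unfolding minimal_absorbing_def absorbing_def by blast+
  then obtain x0 where x0: "x0 \<in> B" unfolding absorbing_def by blast
  define A where "A x z = pmf (a x) z - (if z = x then 1 else 0)" for x z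
  have row: "(\<Sum>z\<in>B. A x z * y z) = (\<Sum>z\<in>B. pmf (a x) z * y z) - y x" if "x \<in> B" for x y
  proof -
    have "A x z * y z = pmf (a x) z * y z - (if z = x then y z else 0)" for z
      by (simp add: A_def algebra_simps)
    then show ?thesis using that finB by (simp add: sum_subtractf)
  qed
  have sup: "set_pmf (a x) \<subseteq> B" if "x \<in> B" for x using absB that unfolding absorbing_def by blast
  from farkas_nonneg[OF finB finB x0, of A] consider
      m where "\<forall>x\<in>B. 0 \<le> m x" "0 < m x0" "\<forall>z\<in>B. 0 \<le> (\<Sum>x\<in>B. m x * A x z)"
    | y where "\<forall>x\<in>B. (\<Sum>z\<in>B. A x z * y z) \<le> 0" "(\<Sum>z\<in>B. A x0 z * y z) < 0"
    by blast
  then show ?thesis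
  proof cases
    case 1
    have "(\<Sum>z\<in>B. \<Sum>x\<in>B. m x * A x z) = (\<Sum>x\<in>B. m x * (\<Sum>z\<in>B. A x z))"
      by (subst sum.swap) (simp add: sum_distrib_left)
    also have "\<dots> = 0"
      using row[of _ "\<lambda>_. 1"] sum_pmf_eq_1[OF finB sup] by (intro sum.neutral) simp
    finally have eq: "(\<Sum>x\<in>B. m x * A x z) = 0" if "z \<in> B" for z
      using 1(3) that finB by (simp add: sum_nonneg_eq_0_iff)
    have tot: "0 < sum m B" using 1 x0 finB by (intro sum_pos2[of B x0]) auto
    obtain p where p: "set_pmf p \<subseteq> B" "\<forall>x\<in>B. pmf p x = m x / sum m B"
      using ex_pmf_of_weights[OF finB, of "\<lambda>x. m x / sum m B"] 1 tot
      by (auto simp flip: sum_divide_distrib)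
    have "bind_pmf p a = p"
    proof (rule pmf_eqI)
      fix z
      have *: "pmf (bind_pmf p a) z = (\<Sum>x\<in>B. m x * pmf (a x) z) / sum m B"
        using p by (simp add: pmf_bind_finite[OF finB p(1)] sum_divide_distrib)
      show "pmf (bind_pmf p a) z = pmf p z"
      proof (cases "z \<in> B")
        case True
        have "m x * A x z = m x * pmf (a x) z - (if z = x then m x else 0)" for x
          by (simp add: A_def algebra_simps)
        then have "(\<Sum>x\<in>B. m x * pmf (a x) z) = m z"
          using eq[OF True] finB True by (simp add: sum_subtractf)
        then show ?thesis using * True p by simp
      next
        case False
        then have "z \<notin> set_pmf p" "\<And>x. x \<in> B \<Longrightarrow> z \<notin> set_pmf (a x)" using p sup by auto
        then show ?thesis unfolding * by (simp add: set_pmf_iff)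
      qed
    qed
    then have "stationary a p" unfolding stationary_def .
    then show ?thesis using minimal_absorbing_support[OF B _ p(1)] by blast
  next
    case (2 y)
    have "absorbing C a {x \<in> B. \<forall>z\<in>B. - y z \<le> - y x}" (is "absorbing C a ?M")
      using 2(1) row[of _ y] by (intro argmax_absorbing finB absB) (auto simp: sum_negf)
    then have "\<not> ?M \<subset> B" using B unfolding minimal_absorbing_def by blast
    then have "?M = B" by blast
    then have "\<forall>x\<in>B. \<forall>z\<in>B. - y z \<le> - y x" by blast
    then have const: "y z = y x0" if "z \<in> B" for z
      using that x0 by (meson antisym neg_le_iff_le)
    have "(\<Sum>z\<in>B. A x0 z * y z) = (\<Sum>z\<in>B. pmf (a x0) z) * y x0 - y x0"
      unfolding row[OF x0] by (simp add: const sum_distrib_right)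
    then show ?thesis using 2(2) sum_pmf_eq_1[OF finB sup[OF x0]] by simp
  qed
qed

section \<open>Multilinearity of the utilities\<close>

text \<open>Finiteness without nonemptiness: it passes to dual reductions at once, whereas nonemptiness
  of the reduced strategy sets depends on the existence of stationary strategies.\<close>

definition finite_actions :: "('i, 's) game \<Rightarrow> bool" where
  "finite_actions \<Gamma> \<longleftrightarrow> finite (players \<Gamma>) \<and> (\<forall>i\<in>players \<Gamma>. finite (strats \<Gamma> i))"

lemma finite_actionsD:
  assumes "finite_actions \<Gamma>"
  shows "finite (players \<Gamma>)" "i \<in> players \<Gamma> \<Longrightarrow> finite (strats \<Gamma> i)" "finite (profiles \<Gamma>)"
  using assms unfolding finite_actions_def profiles_def by (auto intro: finite_PiE)

lemma profiles_upd:
  "c \<in> profiles \<Gamma> \<Longrightarrow> i \<in> players \<Gamma> \<Longrightarrow> d \<in> strats \<Gamma> i \<Longrightarrow> c(i := d) \<in> profiles \<Gamma>"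
  unfolding profiles_def by (auto simp: PiE_def extensional_def)

lemma profiles_strat: "c \<in> profiles \<Gamma> \<Longrightarrow> i \<in> players \<Gamma> \<Longrightarrow> c i \<in> strats \<Gamma> i"
  unfolding profiles_def by auto

lemma mixed_util_cong:
  "(\<And>j. j \<in> players \<Gamma> \<Longrightarrow> \<sigma> j = \<tau> j) \<Longrightarrow> mixed_util \<Gamma> i \<sigma> = mixed_util \<Gamma> i \<tau>"
  unfolding mixed_util_def by (simp cong: prod.cong)

text \<open>The kernels \<open>\<kappa> j\<close> act independently for the players. Taking \<open>return_pmf\<close> for all players but
  one gives the effect of a deviation plan of that player on a profile of mixed strategies.\<close>

lemma mixed_util_bind:
  assumes fin: "finite_actions \<Gamma>"
    and \<rho>: "\<And>j. j \<in> players \<Gamma> \<Longrightarrow> set_pmf (\<rho> j) \<subseteq> strats \<Gamma> j"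
  shows "(\<Sum>c\<in>profiles \<Gamma>. (\<Prod>j\<in>players \<Gamma>. pmf (\<rho> j) (c j)) * mixed_util \<Gamma> i (\<lambda>j. \<kappa> j (c j)))
    = mixed_util \<Gamma> i (\<lambda>j. bind_pmf (\<rho> j) (\<kappa> j))"
proof -
  have "(\<Sum>c\<in>profiles \<Gamma>. (\<Prod>j\<in>players \<Gamma>. pmf (\<rho> j) (c j)) * mixed_util \<Gamma> i (\<lambda>j. \<kappa> j (c j)))
      = (\<Sum>c\<in>profiles \<Gamma>. \<Sum>e\<in>profiles \<Gamma>.
          (\<Prod>j\<in>players \<Gamma>. pmf (\<rho> j) (c j) * pmf (\<kappa> j (c j)) (e j)) * util \<Gamma> i e)"
    by (simp add: mixed_util_def prod.distrib sum_distrib_left mult.assoc)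
  also have "\<dots> = (\<Sum>e\<in>profiles \<Gamma>. \<Sum>c\<in>PiE (players \<Gamma>) (strats \<Gamma>).
          (\<Prod>j\<in>players \<Gamma>. pmf (\<rho> j) (c j) * pmf (\<kappa> j (c j)) (e j)) * util \<Gamma> i e)"
    unfolding profiles_def by (rule sum.swap)
  also have "\<dots> = (\<Sum>e\<in>profiles \<Gamma>.
          (\<Prod>j\<in>players \<Gamma>. \<Sum>d\<in>strats \<Gamma> j. pmf (\<rho> j) d * pmf (\<kappa> j d) (e j)) * util \<Gamma> i e)"
    using finite_actionsD[OF fin] by (simp add: sum_distrib_right[symmetric] prod_sum_PiE)
  also have "\<dots> = mixed_util \<Gamma> i (\<lambda>j. bind_pmf (\<rho> j) (\<kappa> j))"
    unfolding mixed_util_def using finite_actionsD(2)[OF fin] \<rho>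
    by (intro sum.cong prod.cong arg_cong2[where f = "(*)"] refl pmf_bind_finite[symmetric])
  finally show ?thesis .
qed

lemma mixed_util_return:
  assumes fin: "finite_actions \<Gamma>" and c: "c \<in> profiles \<Gamma>"
  shows "mixed_util \<Gamma> i (\<lambda>j. return_pmf (c j)) = util \<Gamma> i c"
proof -
  have *: "(\<Prod>j\<in>players \<Gamma>. pmf (return_pmf (c j)) (e j)) = (if e = c then 1 else 0)"
    if "e \<in> profiles \<Gamma>" for e
  proof (cases "e = c")
    case False
    then obtain j where "e j \<noteq> c j" by blast
    moreover from this have "j \<in> players \<Gamma>"
      using that c unfolding profiles_def by (metis PiE_arb)
    ultimately have "(\<Prod>j\<in>players \<Gamma>. pmf (return_pmf (c j)) (e j)) = 0"
      using finite_actionsD(1)[OF fin] by (intro prod_zero)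
        (auto simp: pmf_return intro!: bexI[of _ j])
    then show ?thesis using False by simp
  qed simp
  have "mixed_util \<Gamma> i (\<lambda>j. return_pmf (c j))
      = (\<Sum>e\<in>profiles \<Gamma>. if e = c then util \<Gamma> i e else 0)"
    unfolding mixed_util_def using * by (intro sum.cong) auto
  then show ?thesis using finite_actionsD(3)[OF fin] c by simp
qed

lemma mixed_util_linear:
  assumes fin: "finite_actions \<Gamma>"
    and j: "j \<in> players \<Gamma>" and p: "set_pmf p \<subseteq> strats \<Gamma> j"
  shows "mixed_util \<Gamma> i (\<sigma>(j := p))
    = (\<Sum>d\<in>strats \<Gamma> j. pmf p d * mixed_util \<Gamma> i (\<sigma>(j := return_pmf d)))"
proof -
  have split: "(\<Prod>l\<in>players \<Gamma>. pmf ((\<sigma>(j := q)) l) (e l))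
      = pmf q (e j) * (\<Prod>l\<in>players \<Gamma> - {j}. pmf (\<sigma> l) (e l))" for q e
  proof -
    have "(\<Prod>l\<in>players \<Gamma> - {j}. pmf ((\<sigma>(j := q)) l) (e l))
        = (\<Prod>l\<in>players \<Gamma> - {j}. pmf (\<sigma> l) (e l))" by (rule prod.cong) auto
    then show ?thesis using prod.remove[OF finite_actionsD(1)[OF fin] j, of "\<lambda>l. pmf ((\<sigma>(j := q)) l) (e l)"]
      by simp
  qed
  have bind: "pmf p x = (\<Sum>d\<in>strats \<Gamma> j. pmf p d * pmf (return_pmf d) x)" for x
    using pmf_bind_finite[OF finite_actionsD(2)[OF fin j] p, of return_pmf x]
    by (simp add: bind_return_pmf')
  have "mixed_util \<Gamma> i (\<sigma>(j := p)) = (\<Sum>e\<in>profiles \<Gamma>. \<Sum>d\<in>strats \<Gamma> j.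
      pmf p d * ((pmf (return_pmf d) (e j) * (\<Prod>l\<in>players \<Gamma> - {j}. pmf (\<sigma> l) (e l))) * util \<Gamma> i e))"
    unfolding mixed_util_def split
    by (subst bind) (simp add: sum_distrib_right mult.assoc)
  also have "\<dots> = (\<Sum>d\<in>strats \<Gamma> j. pmf p d * mixed_util \<Gamma> i (\<sigma>(j := return_pmf d)))"
    unfolding mixed_util_def split by (subst sum.swap) (simp only: sum_distrib_left)
  finally show ?thesis .
qed

lemma mixed_util_deviation:
  assumes fin: "finite_actions \<Gamma>"
    and i: "i \<in> players \<Gamma>" and p: "set_pmf p \<subseteq> strats \<Gamma> i" and c: "c \<in> profiles \<Gamma>"
  shows "mixed_util \<Gamma> i ((\<lambda>j. return_pmf (c j))(i := p))
    = (\<Sum>d\<in>strats \<Gamma> i. pmf p d * util \<Gamma> i (c(i := d)))"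
proof -
  have "mixed_util \<Gamma> i ((\<lambda>j. return_pmf (c j))(i := return_pmf d)) = util \<Gamma> i (c(i := d))"
    if "d \<in> strats \<Gamma> i" for d
  proof -
    have "(\<lambda>j. return_pmf (c j))(i := return_pmf d) = (\<lambda>j. return_pmf ((c(i := d)) j))"
      by auto
    then show ?thesis using mixed_util_return[OF fin profiles_upd[OF c i that]] by simp
  qed
  then show ?thesis by (simp add: mixed_util_linear[OF fin i p])
qed

section \<open>Dual vectors and correlated equilibria\<close>

text \<open>The quantity that a dual vector keeps nonnegative at \<open>c\<close>. It is named because elimination
  depends on a dual vector for which it is strictly positive at a given profile.\<close>

definition plan_gain :: "('i, 's) game \<Rightarrow> ('i \<Rightarrow> 's \<Rightarrow> 's pmf) \<Rightarrow> ('i \<Rightarrow> 's) \<Rightarrow> real" where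
  "plan_gain \<Gamma> \<alpha> c = (\<Sum>i\<in>players \<Gamma>.
     mixed_util \<Gamma> i ((\<lambda>j. return_pmf (c j))(i := \<alpha> i (c i))) - util \<Gamma> i c)"

lemma plan_gain_eq:
  assumes fin: "finite_actions \<Gamma>"
    and \<alpha>: "\<And>i. i \<in> players \<Gamma> \<Longrightarrow> deviation_plan (strats \<Gamma> i) (\<alpha> i)" and c: "c \<in> profiles \<Gamma>"
  shows "plan_gain \<Gamma> \<alpha> c = (\<Sum>i\<in>players \<Gamma>. \<Sum>d\<in>strats \<Gamma> i.
    pmf (\<alpha> i (c i)) d * (util \<Gamma> i (c(i := d)) - util \<Gamma> i c))"
  unfolding plan_gain_def
proof (intro sum.cong refl)
  fix i assume i: "i \<in> players \<Gamma>"
  have sup: "set_pmf (\<alpha> i (c i)) \<subseteq> strats \<Gamma> i"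
    using \<alpha>[OF i] profiles_strat[OF c i] unfolding deviation_plan_def by blast
  show "mixed_util \<Gamma> i ((\<lambda>j. return_pmf (c j))(i := \<alpha> i (c i))) - util \<Gamma> i c
      = (\<Sum>d\<in>strats \<Gamma> i. pmf (\<alpha> i (c i)) d * (util \<Gamma> i (c(i := d)) - util \<Gamma> i c))"
    using sum_pmf_eq_1[OF finite_actionsD(2)[OF fin i] sup]
    by (simp add: mixed_util_deviation[OF fin i sup c] right_diff_distrib sum_subtractf
        flip: sum_distrib_right)
qed

lemma dual_vector_plan_gain:
  "dual_vector \<Gamma> \<alpha> \<longleftrightarrow> (\<forall>i\<in>players \<Gamma>. deviation_plan (strats \<Gamma> i) (\<alpha> i)) \<and>
     (\<forall>c\<in>profiles \<Gamma>. 0 \<le> plan_gain \<Gamma> \<alpha> c)"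
  unfolding dual_vector_def plan_gain_def ..

text \<open>Averaging over independent mixed strategies turns the plan of player \<open>i\<close> into the
  replacement of \<open>\<rho> i\<close> by its image under \<open>\<alpha> i\<close>. Players whose strategy is stationary therefore
  contribute \<open>0\<close>, and it is for this reason that stationary strategies are compatible with dual
  vectors.\<close>

lemma expected_plan_gain:
  assumes fin: "finite_actions \<Gamma>"
    and \<rho>: "\<And>j. j \<in> players \<Gamma> \<Longrightarrow> set_pmf (\<rho> j) \<subseteq> strats \<Gamma> j"
  shows "(\<Sum>c\<in>profiles \<Gamma>. (\<Prod>j\<in>players \<Gamma>. pmf (\<rho> j) (c j)) * plan_gain \<Gamma> \<alpha> c)
    = (\<Sum>i\<in>players \<Gamma>. mixed_util \<Gamma> i (\<rho>(i := bind_pmf (\<rho> i) (\<alpha> i))) - mixed_util \<Gamma> i \<rho>)"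
proof -
  have dev: "(\<Sum>c\<in>profiles \<Gamma>. (\<Prod>j\<in>players \<Gamma>. pmf (\<rho> j) (c j)) *
      mixed_util \<Gamma> i ((\<lambda>j. return_pmf (c j))(i := \<alpha> i (c i))))
    = mixed_util \<Gamma> i (\<rho>(i := bind_pmf (\<rho> i) (\<alpha> i)))" for i
  proof -
    have "(\<lambda>j. return_pmf (c j))(i := \<alpha> i (c i))
        = (\<lambda>j. (if j = i then \<alpha> i else return_pmf) (c j))" for c by auto
    moreover have "\<rho>(i := bind_pmf (\<rho> i) (\<alpha> i))
        = (\<lambda>j. bind_pmf (\<rho> j) (if j = i then \<alpha> i else return_pmf))"
      by (auto simp: bind_return_pmf')
    ultimately show ?thesis
      using mixed_util_bind[OF fin \<rho>, of i "\<lambda>j. if j = i then \<alpha> i else return_pmf"] by simp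
  qed
  have "(\<Sum>c\<in>profiles \<Gamma>. (\<Prod>j\<in>players \<Gamma>. pmf (\<rho> j) (c j)) * plan_gain \<Gamma> \<alpha> c)
    = (\<Sum>i\<in>players \<Gamma>. \<Sum>c\<in>profiles \<Gamma>. (\<Prod>j\<in>players \<Gamma>. pmf (\<rho> j) (c j)) *
      mixed_util \<Gamma> i ((\<lambda>j. return_pmf (c j))(i := \<alpha> i (c i)))
      - (\<Prod>j\<in>players \<Gamma>. pmf (\<rho> j) (c j)) * util \<Gamma> i c)"
    unfolding plan_gain_def
    by (subst sum.swap) (simp add: sum_distrib_left right_diff_distrib)
  then show ?thesis by (simp add: sum_subtractf dev mixed_util_def[of _ _ \<rho>])
qed

text \<open>Linear programming duality between correlated equilibria and dual vectors. A nonnegative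
  vector satisfying the incentive constraints is, up to normalisation, a correlated equilibrium,
  so none gives weight to \<open>c0\<close>. The multipliers \<open>y (i, a, d)\<close> of the incentive constraints
  supplied by the other alternative become, after scaling, the probabilities of switching from \<open>a\<close>
  to \<open>d\<close>.\<close>

lemma ex_strict_dual_vector:
  assumes fin: "finite_actions \<Gamma>"
    and c0: "c0 \<in> profiles \<Gamma>"
    and zero: "\<And>\<mu>. correlated_equilibrium \<Gamma> \<mu> \<Longrightarrow> pmf \<mu> c0 = 0"
  shows "\<exists>\<beta>. dual_vector \<Gamma> \<beta> \<and> 0 < plan_gain \<Gamma> \<beta> c0"
proof -
  note finX = finite_actionsD(3)[OF fin]
  let ?K = "SIGMA i:players \<Gamma>. strats \<Gamma> i \<times> strats \<Gamma> i"
  have finK: "finite ?K" using finite_actionsD[OF fin] by auto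
  define A where "A c = (\<lambda>(i, a, d). if c i = a then util \<Gamma> i c - util \<Gamma> i (c(i := d)) else 0)" for c
  have sumK: "(\<Sum>k\<in>?K. A c k * y k)
      = (\<Sum>i\<in>players \<Gamma>. \<Sum>d\<in>strats \<Gamma> i. y (i, c i, d) * (util \<Gamma> i c - util \<Gamma> i (c(i := d))))"
    if c: "c \<in> profiles \<Gamma>" for c y
  proof -
    have "(\<Sum>k\<in>?K. A c k * y k)
        = (\<Sum>i\<in>players \<Gamma>. \<Sum>a\<in>strats \<Gamma> i. \<Sum>d\<in>strats \<Gamma> i. A c (i, a, d) * y (i, a, d))"
      using finite_actionsD[OF fin] by (simp add: sum.Sigma sum.cartesian_product split_def)
    also have "\<dots> = (\<Sum>i\<in>players \<Gamma>. \<Sum>a\<in>strats \<Gamma> i. if c i = a then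
        (\<Sum>d\<in>strats \<Gamma> i. y (i, a, d) * (util \<Gamma> i c - util \<Gamma> i (c(i := d)))) else 0)"
      by (intro sum.cong refl) (auto simp: A_def mult.commute)
    finally show ?thesis using finite_actionsD(2)[OF fin] profiles_strat[OF c] by simp
  qed
  from farkas_nonneg[OF finX finK c0, of A] consider
      m where "\<forall>c\<in>profiles \<Gamma>. 0 \<le> m c" "0 < m c0" "\<forall>k\<in>?K. 0 \<le> (\<Sum>c\<in>profiles \<Gamma>. m c * A c k)"
    | y where "\<forall>k\<in>?K. 0 \<le> y k" "\<forall>c\<in>profiles \<Gamma>. (\<Sum>k\<in>?K. A c k * y k) \<le> 0"
        "(\<Sum>k\<in>?K. A c0 k * y k) < 0"
    by (elim disjE exE conjE) simp_all
  then show ?thesis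
  proof cases
    case 1
    define M where "M = sum m (profiles \<Gamma>)"
    have "0 < M" unfolding M_def using 1 c0 finX by (intro sum_pos2[of _ c0]) auto
    then obtain \<mu> where \<mu>: "set_pmf \<mu> \<subseteq> profiles \<Gamma>" "\<forall>c\<in>profiles \<Gamma>. pmf \<mu> c = m c / M"
      using ex_pmf_of_weights[OF finX, of "\<lambda>c. m c / M"] 1 M_def
      by (auto simp flip: sum_divide_distrib)
    have "correlated_equilibrium \<Gamma> \<mu>"
      unfolding correlated_equilibrium_def
    proof (intro conjI ballI \<mu>(1))
      fix i a d assume *: "i \<in> players \<Gamma>" "a \<in> strats \<Gamma> i" "d \<in> strats \<Gamma> i"
      have "(\<Sum>c | c \<in> profiles \<Gamma> \<and> c i = a. pmf \<mu> c * (util \<Gamma> i (c(i := d)) - util \<Gamma> i c))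
          = (\<Sum>c\<in>profiles \<Gamma>. - (m c * A c (i, a, d)) / M)"
        using \<mu>(2) by (intro sum.mono_neutral_cong_left finX)
          (auto simp: A_def diff_divide_distrib algebra_simps)
      also have "\<dots> = - (\<Sum>c\<in>profiles \<Gamma>. m c * A c (i, a, d)) / M"
        by (simp add: sum_negf sum_divide_distrib)
      also have "\<dots> \<le> 0" using 1(3) * \<open>0 < M\<close> by (auto intro!: divide_nonneg_pos)
      finally show "(\<Sum>c | c \<in> profiles \<Gamma> \<and> c i = a.
          pmf \<mu> c * (util \<Gamma> i (c(i := d)) - util \<Gamma> i c)) \<le> 0" .
    qed
    then have "pmf \<mu> c0 = 0" by (rule zero)
    then show ?thesis using \<mu>(2) c0 1(2) \<open>0 < M\<close> by simp
  next
    case (2 y)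
    \<comment> \<open>With this scale the switching probabilities from any strategy sum to at most \<open>1\<close>; the rest
      of the mass stays put and does not affect the gain.\<close>
    define \<epsilon> where "\<epsilon> = 1 / (1 + sum y ?K)"
    have tot: "0 \<le> sum y ?K" using 2(1) by (intro sum_nonneg) blast
    then have \<epsilon>: "0 < \<epsilon>" unfolding \<epsilon>_def by simp
    have y0: "0 \<le> y (i, a, d)" if "i \<in> players \<Gamma>" "a \<in> strats \<Gamma> i" "d \<in> strats \<Gamma> i" for i a d
      using 2(1) that by blast
    define s where "s i a = (\<Sum>d\<in>strats \<Gamma> i. y (i, a, d))" for i a
    have s: "\<epsilon> * s i a \<le> 1" if "i \<in> players \<Gamma>" "a \<in> strats \<Gamma> i" for i a
    proof -
      have "s i a = sum y ((\<lambda>d. (i, a, d)) ` strats \<Gamma> i)"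
        unfolding s_def by (subst sum.reindex) (auto intro: inj_onI)
      also have "\<dots> \<le> sum y ?K" using 2(1) that finK by (intro sum_mono2) auto
      finally show ?thesis using tot unfolding \<epsilon>_def by (simp add: divide_le_eq)
    qed
    define w where "w i a d = \<epsilon> * y (i, a, d) + (if d = a then 1 - \<epsilon> * s i a else 0)" for i a d
    have "\<exists>p. set_pmf p \<subseteq> strats \<Gamma> i \<and> (\<forall>d\<in>strats \<Gamma> i. pmf p d = w i a d)"
      if ia: "i \<in> players \<Gamma>" "a \<in> strats \<Gamma> i" for i a
    proof (rule ex_pmf_of_weights)
      show "finite (strats \<Gamma> i)" using finite_actionsD(2)[OF fin] ia by blast
      then show "sum (w i a) (strats \<Gamma> i) = 1"
        unfolding w_def using ia by (simp add: sum.distrib flip: s_def sum_distrib_left)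
      show "0 \<le> w i a d" if "d \<in> strats \<Gamma> i" for d
        using s[OF ia] y0[OF ia that] \<epsilon> unfolding w_def by simp
    qed
    then obtain \<beta> where \<beta>: "\<And>i a. i \<in> players \<Gamma> \<Longrightarrow> a \<in> strats \<Gamma> i \<Longrightarrow>
        set_pmf (\<beta> i a) \<subseteq> strats \<Gamma> i \<and> (\<forall>d\<in>strats \<Gamma> i. pmf (\<beta> i a) d = w i a d)"
      by metis
    then have plan: "deviation_plan (strats \<Gamma> i) (\<beta> i)" if "i \<in> players \<Gamma>" for i
      using that unfolding deviation_plan_def by blast
    have gain: "plan_gain \<Gamma> \<beta> c = - \<epsilon> * (\<Sum>k\<in>?K. A c k * y k)" if c: "c \<in> profiles \<Gamma>" for c
    proof -
      have "pmf (\<beta> i (c i)) d * (util \<Gamma> i (c(i := d)) - util \<Gamma> i c)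
          = - \<epsilon> * (y (i, c i, d) * (util \<Gamma> i c - util \<Gamma> i (c(i := d))))"
        if "i \<in> players \<Gamma>" "d \<in> strats \<Gamma> i" for i d
        using \<beta>[OF that(1) profiles_strat[OF c that(1)]] that(2)
        by (auto simp: w_def algebra_simps)
      moreover have "plan_gain \<Gamma> \<beta> c = (\<Sum>i\<in>players \<Gamma>. \<Sum>d\<in>strats \<Gamma> i.
          pmf (\<beta> i (c i)) d * (util \<Gamma> i (c(i := d)) - util \<Gamma> i c))"
        using plan c by (intro plan_gain_eq fin)
      ultimately show ?thesis unfolding sumK[OF c] by (simp add: sum_distrib_left)
    qed
    have "dual_vector \<Gamma> \<beta>"
      unfolding dual_vector_plan_gain using plan gain 2(2) \<epsilon> by (auto simp: mult_le_0_iff)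
    moreover have "0 < plan_gain \<Gamma> \<beta> c0" using gain[OF c0] 2(3) \<epsilon> by (simp add: mult_pos_neg)
    ultimately show ?thesis by blast
  qed
qed

section \<open>Full dual reductions\<close>

lemma mixed_game_simps [simp]:
  "players (mixed_game \<Gamma> S) = players \<Gamma>" "strats (mixed_game \<Gamma> S) = S"
  "util (mixed_game \<Gamma> S) = mixed_util \<Gamma>"
  unfolding mixed_game_def by simp_all

lemma profiles_mixed_game: "profiles (mixed_game \<Gamma> S) = PiE (players \<Gamma>) S"
  unfolding profiles_def by simp

lemma finite_actions_dual_reduction:
  assumes "finite_actions \<Gamma>"
  shows "finite_actions (dual_reduction \<Gamma> \<alpha>)"
  unfolding finite_actions_def dual_reduction_def
proof (intro conjI ballI)
  fix i assume "i \<in> players (mixed_game \<Gamma> (\<lambda>i. reduced_strats (strats \<Gamma> i) (\<alpha> i)))"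
  then have "finite (strats \<Gamma> i)" using finite_actionsD(2)[OF assms] by simp
  from finite_disjoint_supports[OF this disjoint_supports_reduced_strats[OF this] reduced_strats_support]
  show "finite (strats (mixed_game \<Gamma> (\<lambda>i. reduced_strats (strats \<Gamma> i) (\<alpha> i))) i)" by simp
qed (simp add: finite_actionsD(1)[OF assms])

text \<open>Adding half of \<open>\<beta>\<close> to half of \<open>\<alpha>\<close> gives a dual vector \<open>\<gamma>\<close> with a strict gain at \<open>c\<close>.
  Fullness of \<open>\<alpha>\<close> is what keeps the supports, and hence the minimal absorbing sets, those of \<open>\<alpha>\<close>.
  If \<open>c\<close> were not eliminated, it would lie in a product of minimal absorbing sets, on which there
  is a product \<open>\<rho>\<close> of \<open>\<gamma>\<close>-stationary strategies with full support. The expected gain of \<open>\<gamma>\<close> under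
  \<open>\<rho>\<close> is zero by stationarity, but positive because the gain is nonnegative everywhere and
  positive at \<open>c\<close>.\<close>

lemma full_dual_reduction_eliminates:
  assumes fin: "finite_actions \<Gamma>" and full: "full_dual_vector \<Gamma> \<alpha>"
    and c: "c \<in> profiles \<Gamma>" and \<beta>: "dual_vector \<Gamma> \<beta>" "0 < plan_gain \<Gamma> \<beta> c"
    and \<sigma>: "\<sigma> \<in> profiles (dual_reduction \<Gamma> \<alpha>)"
  shows "\<exists>i\<in>players \<Gamma>. pmf (\<sigma> i) (c i) = 0"
proof (rule ccontr)
  assume neg: "\<not> ?thesis"
  have \<alpha>: "dual_vector \<Gamma> \<alpha>" using full unfolding full_dual_vector_def by blast
  define \<gamma> where "\<gamma> i a = bind_pmf (bernoulli_pmf (1/2)) (\<lambda>b. if b then \<alpha> i a else \<beta> i a)" for i a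
  have pmf_\<gamma>: "pmf (\<gamma> i a) d = (pmf (\<alpha> i a) d + pmf (\<beta> i a) d) / 2" for i a d
    unfolding \<gamma>_def by (simp add: pmf_bind)
  have plan: "deviation_plan (strats \<Gamma> i) (\<alpha> i)" "deviation_plan (strats \<Gamma> i) (\<beta> i)"
    if "i \<in> players \<Gamma>" for i
    using \<alpha> \<beta>(1) that unfolding dual_vector_plan_gain by blast+
  have set_\<gamma>: "set_pmf (\<gamma> i a) = set_pmf (\<alpha> i a)" if ia: "i \<in> players \<Gamma>" "a \<in> strats \<Gamma> i" for i a
  proof -
    have "set_pmf (\<beta> i a) \<subseteq> set_pmf (\<alpha> i a)"
    proof
      fix d assume d: "d \<in> set_pmf (\<beta> i a)"
      then have "d \<in> strats \<Gamma> i" using plan(2) ia unfolding deviation_plan_def by blast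
      moreover have "0 < pmf (\<beta> i a) d" using d by (simp add: pmf_positive)
      ultimately have "0 < pmf (\<alpha> i a) d" using full \<beta>(1) ia unfolding full_dual_vector_def by blast
      then show "d \<in> set_pmf (\<alpha> i a)" by (simp add: set_pmf_iff)
    qed
    then show ?thesis unfolding \<gamma>_def by (auto simp: set_bind_pmf set_pmf_bernoulli split: if_splits)
  qed
  have plan_\<gamma>: "deviation_plan (strats \<Gamma> i) (\<gamma> i)" if "i \<in> players \<Gamma>" for i
    using plan(1)[OF that] set_\<gamma>[OF that] unfolding deviation_plan_def by blast
  have gain: "plan_gain \<Gamma> \<gamma> e = (plan_gain \<Gamma> \<alpha> e + plan_gain \<Gamma> \<beta> e) / 2" if e: "e \<in> profiles \<Gamma>" for e
    using plan_gain_eq[OF fin plan(1) e] plan_gain_eq[OF fin plan(2) e]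
      plan_gain_eq[OF fin plan_\<gamma> e]
    by (simp add: pmf_\<gamma> add_divide_distrib distrib_right sum.distrib sum_divide_distrib)
  have nonneg: "0 \<le> plan_gain \<Gamma> \<gamma> e" if "e \<in> profiles \<Gamma>" for e
  proof -
    have "0 \<le> plan_gain \<Gamma> \<alpha> e" "0 \<le> plan_gain \<Gamma> \<beta> e"
      using \<alpha> \<beta>(1) that unfolding dual_vector_plan_gain by blast+
    then show ?thesis unfolding gain[OF that] by simp
  qed
  have pos: "0 < plan_gain \<Gamma> \<gamma> c"
  proof -
    have "0 \<le> plan_gain \<Gamma> \<alpha> c" using \<alpha> c unfolding dual_vector_plan_gain by blast
    then show ?thesis unfolding gain[OF c] using \<beta>(2) by simp
  qed
  have "\<exists>p. stationary (\<gamma> i) p \<and> set_pmf p \<subseteq> strats \<Gamma> i \<and> c i \<in> set_pmf p" if i: "i \<in> players \<Gamma>" for i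
  proof -
    have "\<sigma> i \<in> reduced_strats (strats \<Gamma> i) (\<alpha> i)"
      using profiles_strat[OF \<sigma>] i unfolding dual_reduction_def by simp
    then obtain B where B: "minimal_absorbing (strats \<Gamma> i) (\<alpha> i) B" "set_pmf (\<sigma> i) \<subseteq> B"
      unfolding reduced_strats_def by blast
    have "absorbing (strats \<Gamma> i) (\<gamma> i) = absorbing (strats \<Gamma> i) (\<alpha> i)"
      using set_\<gamma>[OF i] unfolding absorbing_def by (intro ext) (auto 0 4)
    then have B\<gamma>: "minimal_absorbing (strats \<Gamma> i) (\<gamma> i) B"
      using B(1) unfolding minimal_absorbing_def by simp
    have "c i \<in> B" using neg i B(2) by (auto simp: set_pmf_iff)
    moreover have "B \<subseteq> strats \<Gamma> i" using B(1) unfolding minimal_absorbing_def absorbing_def by blast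
    ultimately show ?thesis using ex_stationary[OF finite_actionsD(2)[OF fin i] B\<gamma>] by auto
  qed
  then obtain \<rho> where \<rho>: "\<And>i. i \<in> players \<Gamma> \<Longrightarrow>
      stationary (\<gamma> i) (\<rho> i) \<and> set_pmf (\<rho> i) \<subseteq> strats \<Gamma> i \<and> c i \<in> set_pmf (\<rho> i)"
    by metis
  have "(\<Sum>e\<in>profiles \<Gamma>. (\<Prod>j\<in>players \<Gamma>. pmf (\<rho> j) (e j)) * plan_gain \<Gamma> \<gamma> e)
      = (\<Sum>i\<in>players \<Gamma>. mixed_util \<Gamma> i (\<rho>(i := bind_pmf (\<rho> i) (\<gamma> i))) - mixed_util \<Gamma> i \<rho>)"
    using \<rho> by (intro expected_plan_gain fin) blast
  also have "\<dots> = 0" using \<rho> by (intro sum.neutral) (simp add: stationary_def)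
  moreover have "0 < (\<Sum>e\<in>profiles \<Gamma>. (\<Prod>j\<in>players \<Gamma>. pmf (\<rho> j) (e j)) * plan_gain \<Gamma> \<gamma> e)"
  proof (rule sum_pos2[OF finite_actionsD(3)[OF fin] c])
    show "0 < (\<Prod>j\<in>players \<Gamma>. pmf (\<rho> j) (c j)) * plan_gain \<Gamma> \<gamma> c"
      using \<rho> pos by (intro mult_pos_pos prod_pos) (auto simp: pmf_positive)
    show "0 \<le> (\<Prod>j\<in>players \<Gamma>. pmf (\<rho> j) (e j)) * plan_gain \<Gamma> \<gamma> e" if "e \<in> profiles \<Gamma>" for e
      using nonneg[OF that] by (intro mult_nonneg_nonneg prod_nonneg) auto
  qed
  ultimately show False by simp
qed

section \<open>Correlated equilibria induced by a dual reduction\<close>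

lemma reduced_strats_nonempty:
  assumes "finite C" "absorbing C a A"
  shows "\<exists>p\<in>reduced_strats C a. set_pmf p \<subseteq> A"
proof -
  obtain B where B: "B \<subseteq> A" "minimal_absorbing C a B" using ex_minimal_absorbing[OF assms] by blast
  obtain p where p: "stationary a p" "set_pmf p = B" using ex_stationary[OF assms(1) B(2)] by blast
  then have "p \<in> reduced_strats C a" using B(2) unfolding reduced_strats_def by blast
  then show ?thesis using p B(1) by blast
qed

text \<open>The recommendation of a profile of mixed strategies is carried out independently by the
  players. The value \<open>undefined\<close> outside the set of players makes the outcomes extensional
  profiles.\<close>

definition induced_correlation ::
    "('i, 's) game \<Rightarrow> ('i \<Rightarrow> 's pmf) pmf \<Rightarrow> ('i \<Rightarrow> 's) pmf" where
  "induced_correlation \<Gamma> l = bind_pmf l (Pi_pmf (players \<Gamma>) undefined)"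

lemma pmf_induced_correlation:
  assumes "finite (players \<Gamma>)" "finite \<Sigma>" "set_pmf l \<subseteq> \<Sigma>" "c \<in> profiles \<Gamma>"
  shows "pmf (induced_correlation \<Gamma> l) c = (\<Sum>\<sigma>\<in>\<Sigma>. pmf l \<sigma> * (\<Prod>j\<in>players \<Gamma>. pmf (\<sigma> j) (c j)))"
proof -
  have "pmf (Pi_pmf (players \<Gamma>) undefined \<sigma>) c = (\<Prod>j\<in>players \<Gamma>. pmf (\<sigma> j) (c j))" for \<sigma>
    using assms(4) unfolding profiles_def by (intro pmf_Pi' assms(1)) (metis PiE_arb)
  then show ?thesis
    unfolding induced_correlation_def by (simp add: pmf_bind_finite[OF assms(2,3)])
qed

lemma set_induced_correlation:
  assumes "finite (players \<Gamma>)"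
    and "\<And>\<sigma> j. \<sigma> \<in> set_pmf l \<Longrightarrow> j \<in> players \<Gamma> \<Longrightarrow> set_pmf (\<sigma> j) \<subseteq> strats \<Gamma> j"
  shows "set_pmf (induced_correlation \<Gamma> l) \<subseteq> profiles \<Gamma>"
proof
  fix c assume "c \<in> set_pmf (induced_correlation \<Gamma> l)"
  then obtain \<sigma> where "\<sigma> \<in> set_pmf l" "c \<in> set_pmf (Pi_pmf (players \<Gamma>) undefined \<sigma>)"
    unfolding induced_correlation_def by auto
  then have "\<sigma> \<in> set_pmf l" "c \<in> PiE_dflt (players \<Gamma>) undefined (set_pmf \<circ> \<sigma>)"
    using set_Pi_pmf[OF assms(1), of undefined \<sigma>] by simp_all
  then show "c \<in> profiles \<Gamma>"
    using assms(2) unfolding PiE_dflt_def profiles_def PiE_def extensional_def by auto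
qed

text \<open>A player who draws \<open>a\<close> from \<open>\<sigma> i\<close> and then plays \<open>d\<close> instead faces the same opponents as one
  who plays \<open>d\<close> outright, since the draws are independent.\<close>

lemma mixed_util_obedience:
  assumes fin: "finite_actions \<Gamma>" and i: "i \<in> players \<Gamma>" and a: "a \<in> strats \<Gamma> i" and d: "d \<in> strats \<Gamma> i"
  shows "(\<Sum>c | c \<in> profiles \<Gamma> \<and> c i = a. (\<Prod>j\<in>players \<Gamma>. pmf (\<sigma> j) (c j)) * util \<Gamma> i (c(i := d)))
    = pmf (\<sigma> i) a * mixed_util \<Gamma> i (\<sigma>(i := return_pmf d))"
proof -
  let ?w = "\<lambda>c. \<Prod>j\<in>players \<Gamma> - {i}. pmf (\<sigma> j) (c j)"
  note rem = prod.remove[OF finite_actionsD(1)[OF fin] i]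
  have "(\<Sum>c | c \<in> profiles \<Gamma> \<and> c i = a. (\<Prod>j\<in>players \<Gamma>. pmf (\<sigma> j) (c j)) * util \<Gamma> i (c(i := d)))
      = pmf (\<sigma> i) a * (\<Sum>c | c \<in> profiles \<Gamma> \<and> c i = a. ?w c * util \<Gamma> i (c(i := d)))"
    unfolding sum_distrib_left by (intro sum.cong refl) (simp add: rem mult.assoc)
  also have "(\<Sum>c | c \<in> profiles \<Gamma> \<and> c i = a. ?w c * util \<Gamma> i (c(i := d)))
      = (\<Sum>e | e \<in> profiles \<Gamma> \<and> e i = d. ?w e * util \<Gamma> i e)"
  proof (rule sum.reindex_bij_witness[of _ "\<lambda>e. e(i := a)" "\<lambda>c. c(i := d)"])
    fix c assume "c \<in> {c \<in> profiles \<Gamma>. c i = a}"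
    then show "(c(i := d))(i := a) = c" by auto
    have "?w (c(i := d)) = ?w c" by (rule prod.cong) auto
    then show "?w (c(i := d)) * util \<Gamma> i (c(i := d)) = ?w c * util \<Gamma> i (c(i := d))" by simp
  qed (use profiles_upd[OF _ i] a d in auto)
  also have "\<dots> = mixed_util \<Gamma> i (\<sigma>(i := return_pmf d))"
  proof -
    have "(\<Prod>j\<in>players \<Gamma> - {i}. pmf ((\<sigma>(i := return_pmf d)) j) (e j)) = ?w e" for e
      by (rule prod.cong) auto
    then have "(\<Prod>j\<in>players \<Gamma>. pmf ((\<sigma>(i := return_pmf d)) j) (e j)) = (if e i = d then ?w e else 0)" for e
      unfolding rem by (simp add: pmf_return)
    then show ?thesis
      unfolding mixed_util_def
      by (intro sum.mono_neutral_cong_left finite_actionsD(3)[OF fin]) auto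
  qed
  finally show ?thesis .
qed

text \<open>Against stationary opponents only player \<open>i\<close> contributes to the expected gain of the dual
  vector, so this player cannot lose by following \<open>\<alpha> i\<close>.\<close>

lemma stationary_subharmonic:
  assumes fin: "finite_actions \<Gamma>" and \<alpha>: "dual_vector \<Gamma> \<alpha>"
    and \<sigma>: "\<sigma> \<in> profiles (dual_reduction \<Gamma> \<alpha>)" and i: "i \<in> players \<Gamma>" and a: "a \<in> strats \<Gamma> i"
  shows "mixed_util \<Gamma> i (\<sigma>(i := return_pmf a)) \<le> mixed_util \<Gamma> i (\<sigma>(i := \<alpha> i a))"
proof -
  let ?\<rho> = "\<sigma>(i := return_pmf a)"
  have red: "\<sigma> j \<in> reduced_strats (strats \<Gamma> j) (\<alpha> j)" if "j \<in> players \<Gamma>" for j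
    using profiles_strat[OF \<sigma>, of j] that unfolding dual_reduction_def by simp
  have "0 \<le> (\<Sum>c\<in>profiles \<Gamma>. (\<Prod>j\<in>players \<Gamma>. pmf (?\<rho> j) (c j)) * plan_gain \<Gamma> \<alpha> c)"
    using \<alpha> unfolding dual_vector_plan_gain by (intro sum_nonneg mult_nonneg_nonneg prod_nonneg) auto
  also have "\<dots> = (\<Sum>j\<in>players \<Gamma>. mixed_util \<Gamma> j (?\<rho>(j := bind_pmf (?\<rho> j) (\<alpha> j))) - mixed_util \<Gamma> j ?\<rho>)"
    using reduced_strats_support[OF red] a by (intro expected_plan_gain fin) auto
  also have "\<dots> = (\<Sum>j\<in>{i}. mixed_util \<Gamma> j (?\<rho>(j := bind_pmf (?\<rho> j) (\<alpha> j))) - mixed_util \<Gamma> j ?\<rho>)"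
  proof (intro sum.mono_neutral_right finite_actionsD(1)[OF fin] ballI)
    fix j assume j: "j \<in> players \<Gamma> - {i}"
    then have "bind_pmf (?\<rho> j) (\<alpha> j) = ?\<rho> j"
      using red[of j] by (simp add: reduced_strats_def stationary_def)
    then show "mixed_util \<Gamma> j (?\<rho>(j := bind_pmf (?\<rho> j) (\<alpha> j))) - mixed_util \<Gamma> j ?\<rho> = 0"
      by (simp only: fun_upd_triv diff_self)
  qed (use i in auto)
  finally show ?thesis by (simp add: bind_return_pmf)
qed

text \<open>Fix a recommendation \<open>s\<close> to player \<open>i\<close>, and let \<open>F s p\<close> be the payoff of player \<open>i\<close>,
  weighted by \<open>l\<close>, from playing \<open>p\<close> when \<open>s\<close> is recommended. As a function of pure strategies of
  \<open>\<Gamma>\<close> it does not exceed its mean over the next step of \<open>\<alpha> i\<close>, by \<open>stationary_subharmonic\<close>, so its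
  maximisers form an absorbing set, which contains the support of some strategy of the reduced
  game. The incentive constraints in the reduced game thus bound \<open>F s s\<close> from below by the maximum
  of \<open>F s\<close> over all pure strategies of \<open>\<Gamma>\<close>, and every pure strategy in the support of \<open>s\<close> attains
  this maximum. No deviation from a strategy drawn from \<open>s\<close> can then be profitable.\<close>

lemma correlated_equilibrium_induced:
  assumes fin: "finite_actions \<Gamma>" and \<alpha>: "dual_vector \<Gamma> \<alpha>"
    and l: "correlated_equilibrium (dual_reduction \<Gamma> \<alpha>) l"
  shows "correlated_equilibrium \<Gamma> (induced_correlation \<Gamma> l)"
proof -
  let ?H = "dual_reduction \<Gamma> \<alpha>"
  let ?R = "\<lambda>i. reduced_strats (strats \<Gamma> i) (\<alpha> i)"
  have H [simp]: "players ?H = players \<Gamma>" "strats ?H i = ?R i" "util ?H = mixed_util \<Gamma>" for i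
    unfolding dual_reduction_def by simp_all
  have finH: "finite_actions ?H" using finite_actions_dual_reduction[OF fin] .
  have setl: "set_pmf l \<subseteq> profiles ?H" using l unfolding correlated_equilibrium_def by blast
  show ?thesis
    unfolding correlated_equilibrium_def
  proof (intro conjI ballI)
    show "set_pmf (induced_correlation \<Gamma> l) \<subseteq> profiles \<Gamma>"
    proof (rule set_induced_correlation[OF finite_actionsD(1)[OF fin]])
      fix \<sigma> j assume "\<sigma> \<in> set_pmf l" "j \<in> players \<Gamma>"
      then have "\<sigma> j \<in> ?R j" using setl profiles_strat[of \<sigma> ?H j] by auto
      then show "set_pmf (\<sigma> j) \<subseteq> strats \<Gamma> j" by (rule reduced_strats_support)
    qed
  next
    fix i a d assume i: "i \<in> players \<Gamma>" and a: "a \<in> strats \<Gamma> i" and d: "d \<in> strats \<Gamma> i"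
    define F where "F s p = (\<Sum>\<sigma> | \<sigma> \<in> profiles ?H \<and> \<sigma> i = s. pmf l \<sigma> * mixed_util \<Gamma> i (\<sigma>(i := p)))" for s p
    have finC: "finite (strats \<Gamma> i)" using finite_actionsD(2)[OF fin i] .
    have F_linear: "F s p = (\<Sum>z\<in>strats \<Gamma> i. pmf p z * F s (return_pmf z))"
      if "set_pmf p \<subseteq> strats \<Gamma> i" for s p
      unfolding F_def mixed_util_linear[OF fin i that] sum_distrib_left
      by (subst sum.swap) (simp add: mult_ac)
    have F_eq: "F s \<tau> \<le> F s s" if s: "s \<in> ?R i" "\<tau> \<in> ?R i" for s \<tau>
    proof -
      have "(\<Sum>\<sigma> | \<sigma> \<in> profiles ?H \<and> \<sigma> i = s.
          pmf l \<sigma> * (mixed_util \<Gamma> i (\<sigma>(i := \<tau>)) - mixed_util \<Gamma> i \<sigma>)) \<le> 0"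
        using l i s unfolding correlated_equilibrium_def by simp
      moreover have "F s s = (\<Sum>\<sigma> | \<sigma> \<in> profiles ?H \<and> \<sigma> i = s. pmf l \<sigma> * mixed_util \<Gamma> i \<sigma>)"
        unfolding F_def by (intro sum.cong) auto
      ultimately show ?thesis by (simp add: F_def right_diff_distrib sum_subtractf)
    qed
    have F_sub: "F s (return_pmf x) \<le> (\<Sum>z\<in>strats \<Gamma> i. pmf (\<alpha> i x) z * F s (return_pmf z))"
      if x: "x \<in> strats \<Gamma> i" for s x
    proof -
      have "F s (return_pmf x) \<le> F s (\<alpha> i x)"
        unfolding F_def using stationary_subharmonic[OF fin \<alpha> _ i x]
        by (intro sum_mono mult_left_mono) auto
      moreover have "set_pmf (\<alpha> i x) \<subseteq> strats \<Gamma> i"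
        using \<alpha> i x unfolding dual_vector_def deviation_plan_def by blast
      ultimately show ?thesis using F_linear by simp
    qed
    have F_max: "F s (return_pmf d) \<le> F s (return_pmf a)" if s: "s \<in> ?R i" "a \<in> set_pmf s" for s
    proof -
      have "absorbing (strats \<Gamma> i) (\<alpha> i) (strats \<Gamma> i)"
        using \<alpha> i a unfolding absorbing_def dual_vector_def deviation_plan_def by blast
      from reduced_strats_nonempty[OF finC argmax_absorbing[OF finC this F_sub]]
      obtain \<tau> where \<tau>: "\<tau> \<in> ?R i"
        "set_pmf \<tau> \<subseteq> {x \<in> strats \<Gamma> i. \<forall>z\<in>strats \<Gamma> i. F s (return_pmf z) \<le> F s (return_pmf x)}"
        by blast
      obtain x where x: "x \<in> set_pmf \<tau>" using set_pmf_not_empty[of \<tau>] by auto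
      let ?M = "F s (return_pmf x)"
      have le: "F s (return_pmf z) \<le> ?M" if "z \<in> strats \<Gamma> i" for z using x \<tau>(2) that by blast
      have sup: "set_pmf s \<subseteq> strats \<Gamma> i" "set_pmf \<tau> \<subseteq> strats \<Gamma> i"
        using s \<tau> reduced_strats_support by blast+
      have "F s \<tau> = (\<Sum>z\<in>strats \<Gamma> i. pmf \<tau> z * ?M)"
        unfolding F_linear[OF sup(2)]
      proof (intro sum.cong refl)
        fix z assume z: "z \<in> strats \<Gamma> i"
        show "pmf \<tau> z * F s (return_pmf z) = pmf \<tau> z * ?M"
        proof (cases "z \<in> set_pmf \<tau>")
          case True
          then have "?M \<le> F s (return_pmf z)" using \<tau>(2) x by blast
          then show ?thesis using le[OF z] by simp
        qed (simp add: set_pmf_iff)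
      qed
      then have "F s \<tau> = ?M" using sum_pmf_eq_1[OF finC sup(2)] by (simp flip: sum_distrib_right)
      then have "?M \<le> F s s" using F_eq[OF s(1) \<tau>(1)] by simp
      moreover have "(\<Sum>z\<in>strats \<Gamma> i. pmf s z * (?M - F s (return_pmf z))) = ?M - F s s"
        unfolding F_linear[OF sup(1)]
        using sum_pmf_eq_1[OF finC sup(1)]
        by (simp add: right_diff_distrib sum_subtractf flip: sum_distrib_right)
      moreover have "pmf s a * (?M - F s (return_pmf a)) \<le>
          (\<Sum>z\<in>strats \<Gamma> i. pmf s z * (?M - F s (return_pmf z)))"
        using le a finC by (intro member_le_sum) auto
      ultimately have "pmf s a * (?M - F s (return_pmf a)) \<le> 0" by linarith
      then have "?M \<le> F s (return_pmf a)"
        using s(2) pmf_positive[of a s] by (auto simp: mult_le_0_iff)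
      then show ?thesis using le[OF d] by linarith
    qed
    \<comment> \<open>Conditioning on the recommendation splits the payoff from playing \<open>e\<close> after drawing \<open>a\<close>
      into the payoffs \<open>F s\<close>.\<close>
    have deviate: "(\<Sum>c | c \<in> profiles \<Gamma> \<and> c i = a. pmf (induced_correlation \<Gamma> l) c * util \<Gamma> i (c(i := e)))
        = (\<Sum>s\<in>?R i. pmf s a * F s (return_pmf e))" if e: "e \<in> strats \<Gamma> i" for e
    proof -
      have "(\<Sum>c | c \<in> profiles \<Gamma> \<and> c i = a. pmf (induced_correlation \<Gamma> l) c * util \<Gamma> i (c(i := e)))
          = (\<Sum>c | c \<in> profiles \<Gamma> \<and> c i = a. \<Sum>\<sigma>\<in>profiles ?H.
              pmf l \<sigma> * ((\<Prod>j\<in>players \<Gamma>. pmf (\<sigma> j) (c j)) * util \<Gamma> i (c(i := e))))"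
        using pmf_induced_correlation[OF finite_actionsD(1)[OF fin] finite_actionsD(3)[OF finH] setl]
        by (intro sum.cong refl) (simp add: sum_distrib_right mult.assoc)
      also have "\<dots> = (\<Sum>\<sigma>\<in>profiles ?H. pmf l \<sigma> * (pmf (\<sigma> i) a * mixed_util \<Gamma> i (\<sigma>(i := return_pmf e))))"
        by (subst sum.swap) (simp add: mixed_util_obedience[OF fin i a e] flip: sum_distrib_left)
      also have "\<dots> = (\<Sum>s\<in>?R i. \<Sum>\<sigma> | \<sigma> \<in> profiles ?H \<and> \<sigma> i = s.
          pmf l \<sigma> * (pmf (\<sigma> i) a * mixed_util \<Gamma> i (\<sigma>(i := return_pmf e))))"
        using finite_actionsD(3)[OF finH] finite_actionsD(2)[OF finH, of i] i profiles_strat[of _ ?H i]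
        by (intro sum.group[symmetric]) auto
      also have "\<dots> = (\<Sum>s\<in>?R i. pmf s a * F s (return_pmf e))"
        unfolding F_def sum_distrib_left by (intro sum.cong refl) (auto simp: mult_ac)
      finally show ?thesis .
    qed
    have "(\<Sum>c | c \<in> profiles \<Gamma> \<and> c i = a.
        pmf (induced_correlation \<Gamma> l) c * (util \<Gamma> i (c(i := d)) - util \<Gamma> i c))
      = (\<Sum>c | c \<in> profiles \<Gamma> \<and> c i = a. pmf (induced_correlation \<Gamma> l) c * util \<Gamma> i (c(i := d)))
      - (\<Sum>c | c \<in> profiles \<Gamma> \<and> c i = a. pmf (induced_correlation \<Gamma> l) c * util \<Gamma> i (c(i := a)))"
      unfolding sum_subtractf[symmetric]
      by (intro sum.cong refl) (auto simp: right_diff_distrib)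
    also have "\<dots> = (\<Sum>s\<in>?R i. pmf s a * (F s (return_pmf d) - F s (return_pmf a)))"
      unfolding deviate[OF d] deviate[OF a] by (simp add: right_diff_distrib sum_subtractf)
    also have "\<dots> \<le> 0"
    proof (rule sum_nonpos)
      fix s assume s: "s \<in> ?R i"
      show "pmf s a * (F s (return_pmf d) - F s (return_pmf a)) \<le> 0"
      proof (cases "a \<in> set_pmf s")
        case True
        then show ?thesis using F_max[OF s] by (simp add: mult_nonneg_nonpos)
      qed (simp add: set_pmf_iff)
    qed
    finally show "(\<Sum>c | c \<in> profiles \<Gamma> \<and> c i = a.
        pmf (induced_correlation \<Gamma> l) c * (util \<Gamma> i (c(i := d)) - util \<Gamma> i c)) \<le> 0" .
  qed
qed

section \<open>Iterated reductions\<close>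

text \<open>Used to pass from a dual reduction of a game of mixed strategies, whose strategies are
  mixtures of mixtures, to the game in which these have been composed by \<open>join_pmf\<close>.\<close>

lemma correlated_equilibrium_isomorphic:
  assumes pl: "players H' = players H"
    and bij: "\<And>i. i \<in> players H \<Longrightarrow> bij_betw (\<phi> i) (strats H i) (strats H' i)"
    and util: "\<And>i \<sigma>. i \<in> players H \<Longrightarrow> \<sigma> \<in> profiles H \<Longrightarrow>
      util H' i (\<lambda>j\<in>players H. \<phi> j (\<sigma> j)) = util H i \<sigma>"
    and m: "correlated_equilibrium H' m"
  shows "\<exists>l. correlated_equilibrium H l \<and>
    (\<forall>\<sigma>\<in>profiles H. pmf l \<sigma> = pmf m (\<lambda>j\<in>players H. \<phi> j (\<sigma> j)))"
proof -
  define \<Phi> where "\<Phi> \<sigma> = (\<lambda>j\<in>players H. \<phi> j (\<sigma> j))" for \<sigma>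
  have \<Phi>_upd: "\<Phi> (\<sigma>(i := t)) = (\<Phi> \<sigma>)(i := \<phi> i t)" if "i \<in> players H" for \<sigma> i t
    using that by (auto simp: \<Phi>_def)
  have \<Phi>_app: "\<Phi> \<sigma> i = \<phi> i (\<sigma> i)" if "i \<in> players H" for \<sigma> i
    using that by (simp add: \<Phi>_def)
  have inj: "inj_on \<Phi> (profiles H)"
  proof (rule inj_onI)
    fix \<sigma> \<tau> assume *: "\<sigma> \<in> profiles H" "\<tau> \<in> profiles H" "\<Phi> \<sigma> = \<Phi> \<tau>"
    have "\<sigma> j = \<tau> j" if "j \<in> players H" for j
    proof (rule inj_onD[OF bij_betw_imp_inj_on[OF bij[OF that]]])
      show "\<phi> j (\<sigma> j) = \<phi> j (\<tau> j)" using * \<Phi>_app[OF that] by metis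
    qed (use *(1,2) profiles_strat[OF _ that] in blast)+
    then show "\<sigma> = \<tau>" using * unfolding profiles_def by (intro PiE_ext) auto
  qed
  have surj: "\<Phi> ` profiles H = profiles H'"
  proof (intro equalityI subsetI)
    fix \<sigma>' assume "\<sigma>' \<in> \<Phi> ` profiles H"
    then obtain \<sigma> where "\<sigma> \<in> profiles H" "\<sigma>' = \<Phi> \<sigma>" by blast
    then show "\<sigma>' \<in> profiles H'"
      using bij unfolding profiles_def \<Phi>_def pl by (auto simp: bij_betw_def)
  next
    fix \<sigma>' assume \<sigma>': "\<sigma>' \<in> profiles H'"
    define \<sigma> where "\<sigma> = (\<lambda>j\<in>players H. inv_into (strats H j) (\<phi> j) (\<sigma>' j))"
    have mem: "\<sigma>' j \<in> \<phi> j ` strats H j" if "j \<in> players H" for j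
      using profiles_strat[OF \<sigma>', of j] bij[OF that] that pl by (simp add: bij_betw_def)
    have "\<sigma> \<in> profiles H"
      unfolding profiles_def \<sigma>_def using mem by (auto intro: inv_into_into)
    moreover have "\<Phi> \<sigma> = \<sigma>'"
    proof
      fix j show "\<Phi> \<sigma> j = \<sigma>' j"
      proof (cases "j \<in> players H")
        case True
        then show ?thesis using f_inv_into_f[OF mem[OF True]] by (simp add: \<Phi>_def \<sigma>_def)
      next
        case False
        then have "\<sigma>' j = undefined" using \<sigma>' pl unfolding profiles_def by (metis PiE_arb)
        then show ?thesis using False by (simp add: \<Phi>_def)
      qed
    qed
    ultimately show "\<sigma>' \<in> \<Phi> ` profiles H" by blast
  qed
  have setm: "set_pmf m \<subseteq> profiles H'" using m unfolding correlated_equilibrium_def by blast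
  define l where "l = map_pmf (inv_into (profiles H) \<Phi>) m"
  have "inj_on (inv_into (profiles H) \<Phi>) (profiles H')"
    using inj_on_inv_into[of "profiles H'" \<Phi> "profiles H"] surj by simp
  then have pmf_l: "pmf l \<sigma> = pmf m (\<Phi> \<sigma>)" if "\<sigma> \<in> profiles H" for \<sigma>
  proof -
    have "\<Phi> \<sigma> \<in> profiles H'" using that surj by blast
    show ?thesis
    proof (cases "\<Phi> \<sigma> \<in> set_pmf m")
      case True
      have "pmf l (inv_into (profiles H) \<Phi> (\<Phi> \<sigma>)) = pmf m (\<Phi> \<sigma>)"
        unfolding l_def using \<open>inj_on _ (profiles H')\<close> True setm
        by (intro pmf_map_inj) (auto intro: inj_on_subset)
      then show ?thesis using inj that by simp
    next
      case False
      have "\<sigma> \<notin> set_pmf l"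
      proof
        assume "\<sigma> \<in> set_pmf l"
        then obtain \<sigma>' where "\<sigma>' \<in> set_pmf m" "\<sigma> = inv_into (profiles H) \<Phi> \<sigma>'"
          unfolding l_def by auto
        then have "\<Phi> \<sigma> = \<sigma>'" using setm surj by (metis f_inv_into_f subsetD)
        then show False using False \<open>\<sigma>' \<in> set_pmf m\<close> by simp
      qed
      then show ?thesis using False by (simp add: set_pmf_iff)
    qed
  qed
  have "correlated_equilibrium H l"
    unfolding correlated_equilibrium_def
  proof (intro conjI ballI)
    show "set_pmf l \<subseteq> profiles H"
    proof -
      have "inv_into (profiles H) \<Phi> ` profiles H' \<subseteq> profiles H"
        using surj by (auto intro: inv_into_into)
      then show ?thesis using setm unfolding l_def by auto
    qed
  next
    fix i s t assume i: "i \<in> players H" and st: "s \<in> strats H i" "t \<in> strats H i"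
    have sel: "\<Phi> ` {\<sigma> \<in> profiles H. \<sigma> i = s} = {\<sigma>' \<in> profiles H'. \<sigma>' i = \<phi> i s}"
    proof -
      have "\<sigma> i = s" if "\<sigma> \<in> profiles H" "\<phi> i (\<sigma> i) = \<phi> i s" for \<sigma>
        using inj_onD[OF bij_betw_imp_inj_on[OF bij[OF i]] that(2)] profiles_strat[OF that(1) i] st
        by blast
      then show ?thesis unfolding surj[symmetric] using \<Phi>_app[OF i] by (auto intro!: imageI)
    qed
    have "(\<Sum>\<sigma> | \<sigma> \<in> profiles H \<and> \<sigma> i = s. pmf l \<sigma> * (util H i (\<sigma>(i := t)) - util H i \<sigma>))
        = (\<Sum>\<sigma> | \<sigma> \<in> profiles H \<and> \<sigma> i = s.
            pmf m (\<Phi> \<sigma>) * (util H' i ((\<Phi> \<sigma>)(i := \<phi> i t)) - util H' i (\<Phi> \<sigma>)))"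
    proof (intro sum.cong refl)
      fix \<sigma> assume "\<sigma> \<in> {\<sigma> \<in> profiles H. \<sigma> i = s}"
      then have \<sigma>: "\<sigma> \<in> profiles H" by simp
      have "util H i \<sigma> = util H' i (\<Phi> \<sigma>)" if "\<sigma> \<in> profiles H" for \<sigma>
        using util[OF i that] unfolding \<Phi>_def by simp
      then show "pmf l \<sigma> * (util H i (\<sigma>(i := t)) - util H i \<sigma>)
          = pmf m (\<Phi> \<sigma>) * (util H' i ((\<Phi> \<sigma>)(i := \<phi> i t)) - util H' i (\<Phi> \<sigma>))"
        using \<sigma> profiles_upd[OF \<sigma> i st(2)] pmf_l[OF \<sigma>] by (simp flip: \<Phi>_upd[OF i])
    qed
    also have "\<dots> = (\<Sum>\<sigma>' | \<sigma>' \<in> profiles H' \<and> \<sigma>' i = \<phi> i s.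
            pmf m \<sigma>' * (util H' i (\<sigma>'(i := \<phi> i t)) - util H' i \<sigma>'))"
      unfolding sel[symmetric]
      by (subst sum.reindex) (auto intro: inj_on_subset[OF inj])
    also have "\<dots> \<le> 0"
    proof -
      have "\<phi> i s \<in> strats H' i" "\<phi> i t \<in> strats H' i"
        using st bij_betw_apply[OF bij[OF i]] by blast+
      then show ?thesis using m i pl unfolding correlated_equilibrium_def by simp
    qed
    finally show "(\<Sum>\<sigma> | \<sigma> \<in> profiles H \<and> \<sigma> i = s.
        pmf l \<sigma> * (util H i (\<sigma>(i := t)) - util H i \<sigma>)) \<le> 0" .
  qed
  then show ?thesis using pmf_l unfolding \<Phi>_def by blast
qed

lemma induced_correlation_support:
  assumes fin: "finite (players \<Gamma>)" and c: "c \<in> profiles \<Gamma>" and \<sigma>: "\<sigma> \<in> set_pmf l"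
    and supp: "\<And>i. i \<in> players \<Gamma> \<Longrightarrow> c i \<in> set_pmf (\<sigma> i)"
  shows "c \<in> set_pmf (induced_correlation \<Gamma> l)"
proof -
  have "c i = undefined" if "i \<notin> players \<Gamma>" for i
    using c that unfolding profiles_def by (metis PiE_arb)
  then have "c \<in> set_pmf (Pi_pmf (players \<Gamma>) undefined \<sigma>)"
    unfolding set_Pi_pmf[OF fin] PiE_dflt_def using supp by simp
  then show ?thesis using \<sigma> unfolding induced_correlation_def by auto
qed

lemma iterative_dual_reduction_mixed_game:
  "iterative_dual_reduction \<Gamma> G \<Longrightarrow> G = mixed_game \<Gamma> (strats G)"
  by (induction rule: iterative_dual_reduction.induct) (simp_all add: dual_reduction_def)

text \<open>A correlated equilibrium is pulled back through one reduction after the other; at each stage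
  the support only has to contain what can be drawn from the recommended strategies. In the
  induction step a pure strategy \<open>c j\<close> in the support of a composed mixture is reached in two
  draws: a strategy \<open>q j\<close> of the previous game, then \<open>c j\<close> from \<open>q j\<close>.\<close>

lemma correlated_equilibrium_iterative:
  assumes fg: "finite_game \<Gamma>" and "iterative_dual_reduction \<Gamma> G" "correlated_equilibrium G \<nu>"
  shows "\<exists>\<mu>. correlated_equilibrium \<Gamma> \<mu> \<and> (\<forall>c\<in>profiles \<Gamma>. \<forall>\<sigma>\<in>set_pmf \<nu>.
    (\<forall>i\<in>players \<Gamma>. c i \<in> set_pmf (\<sigma> i)) \<longrightarrow> c \<in> set_pmf \<mu>)"
  using assms(2,3)
proof (induction arbitrary: \<nu>)
  case (single \<alpha>)
  have fin: "finite_actions \<Gamma>" using fg unfolding finite_game_def finite_actions_def by blast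
  show ?case
    using correlated_equilibrium_induced[OF fin single]
      induced_correlation_support[OF finite_actionsD(1)[OF fin]] by blast
next
  case (step G \<alpha>)
  let ?H = "dual_reduction G \<alpha>"
  let ?G' = "mixed_game \<Gamma> (\<lambda>i. join_pmf ` strats ?H i)"
  have G: "G = mixed_game \<Gamma> (strats G)" by (rule iterative_dual_reduction_mixed_game[OF step.hyps(1)])
  then have plG: "players G = players \<Gamma>" by (metis mixed_game_simps(1))
  have H [simp]: "players ?H = players \<Gamma>" "strats ?H i = reduced_strats (strats G i) (\<alpha> i)"
    "util ?H = mixed_util G" for i
    unfolding dual_reduction_def by (simp_all add: plG)
  have finG: "finite_actions G"
    using iterative_dual_reduction_strats[OF fg step.hyps(1)] fg plG
    unfolding finite_actions_def finite_game_def by simp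
  note fin = finite_actionsD[OF finG, unfolded plG]
  have "\<exists>l. correlated_equilibrium ?H l \<and>
      (\<forall>\<tau>\<in>profiles ?H. pmf l \<tau> = pmf \<nu> (\<lambda>j\<in>players ?H. join_pmf (\<tau> j)))"
  proof (rule correlated_equilibrium_isomorphic)
    show "correlated_equilibrium ?G' \<nu>" by (rule step.prems)
    show "players ?G' = players ?H" by simp
  next
    fix i assume i: "i \<in> players ?H"
    have "inj_on join_pmf (strats ?H i)"
    proof (rule inj_on_subset[OF inj_on_join_pmf_iterative[OF fg step.hyps(1)]])
      show "i \<in> players \<Gamma>" using i by simp
      show "strats ?H i \<subseteq> {\<tau>. set_pmf \<tau> \<subseteq> strats G i}"
        by (auto dest: reduced_strats_support)
    qed
    then show "bij_betw join_pmf (strats ?H i) (strats ?G' i)" by (simp add: bij_betw_def)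
  next
    fix i \<tau> assume "i \<in> players ?H" and \<tau>: "\<tau> \<in> profiles ?H"
    have "mixed_util \<Gamma> i (\<lambda>j\<in>players ?H. join_pmf (\<tau> j)) = mixed_util \<Gamma> i (\<lambda>j. join_pmf (\<tau> j))"
      by (rule mixed_util_cong) simp
    also have "\<dots> = mixed_util (mixed_game \<Gamma> (strats G)) i \<tau>"
      using fin profiles_strat[OF \<tau>] by (intro mixed_util_mixed_game[symmetric])
        (auto dest: reduced_strats_support)
    finally show "util ?G' i (\<lambda>j\<in>players ?H. join_pmf (\<tau> j)) = util ?H i \<tau>"
      by (simp add: G[symmetric])
  qed
  then obtain l where l: "correlated_equilibrium ?H l"
    and pmf_l: "\<And>\<tau>. \<tau> \<in> profiles ?H \<Longrightarrow> pmf l \<tau> = pmf \<nu> (\<lambda>j\<in>players \<Gamma>. join_pmf (\<tau> j))"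
    by auto
  obtain \<mu> where \<mu>: "correlated_equilibrium \<Gamma> \<mu>"
    and supp: "\<And>c s. c \<in> profiles \<Gamma> \<Longrightarrow> s \<in> set_pmf (induced_correlation G l) \<Longrightarrow>
      (\<And>i. i \<in> players \<Gamma> \<Longrightarrow> c i \<in> set_pmf (s i)) \<Longrightarrow> c \<in> set_pmf \<mu>"
    using step.IH[OF correlated_equilibrium_induced[OF finG step.hyps(2) l]] by blast
  have "c \<in> set_pmf \<mu>" if c: "c \<in> profiles \<Gamma>" and \<sigma>: "\<sigma> \<in> set_pmf \<nu>"
    and c\<sigma>: "\<forall>i\<in>players \<Gamma>. c i \<in> set_pmf (\<sigma> i)" for c \<sigma>
  proof -
    have \<sigma>P: "\<sigma> \<in> profiles ?G'" using \<sigma> step.prems unfolding correlated_equilibrium_def by blast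
    have "\<exists>t\<in>strats ?H j. \<sigma> j = join_pmf t" if "j \<in> players \<Gamma>" for j
      using profiles_strat[OF \<sigma>P, of j] that by auto
    then obtain t where t: "\<And>j. j \<in> players \<Gamma> \<Longrightarrow> t j \<in> strats ?H j \<and> \<sigma> j = join_pmf (t j)"
      by metis
    define \<tau> where "\<tau> = restrict t (players \<Gamma>)"
    have \<tau>: "\<tau> \<in> profiles ?H" unfolding \<tau>_def profiles_def using t by auto
    have "\<sigma> = restrict \<sigma> (players \<Gamma>)"
      using \<sigma>P unfolding profiles_mixed_game by (metis PiE_restrict)
    also have "\<dots> = (\<lambda>j\<in>players \<Gamma>. join_pmf (\<tau> j))"
      using t by (intro restrict_ext) (simp add: \<tau>_def)
    finally have "\<sigma> = (\<lambda>j\<in>players \<Gamma>. join_pmf (\<tau> j))" .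
    then have "\<tau> \<in> set_pmf l" using pmf_l[OF \<tau>] \<sigma> by (simp add: set_pmf_iff)
    have "\<exists>q\<in>set_pmf (t j). c j \<in> set_pmf q" if "j \<in> players \<Gamma>" for j
      using c\<sigma> t[OF that] that by (auto simp: set_pmf_join_pmf)
    then obtain q where q: "\<And>j. j \<in> players \<Gamma> \<Longrightarrow> q j \<in> set_pmf (t j) \<and> c j \<in> set_pmf (q j)"
      by metis
    define s where "s = restrict q (players \<Gamma>)"
    have "s j \<in> strats G j" if "j \<in> players \<Gamma>" for j
      using q[OF that] t[OF that] that reduced_strats_support[of "t j" "strats G j" "\<alpha> j"]
      unfolding s_def by auto
    then have "s \<in> profiles G"
      unfolding profiles_def plG s_def by (auto intro!: restrict_PiE_iff[THEN iffD2])
    moreover have "s i \<in> set_pmf (\<tau> i)" if "i \<in> players G" for i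
      using that q plG unfolding s_def \<tau>_def by simp
    ultimately have "s \<in> set_pmf (induced_correlation G l)"
      using induced_correlation_support[OF finite_actionsD(1)[OF finG] _ \<open>\<tau> \<in> set_pmf l\<close>] by blast
    then show ?thesis using supp[OF c] q unfolding s_def by simp
  qed
  then show ?case using \<mu> by blast
qed

section \<open>Elimination\<close>

lemma profile_eliminated_iff:
  assumes "finite (players G)"
  shows "profile_eliminated G c \<longleftrightarrow> (\<forall>\<sigma>\<in>profiles G. \<exists>i\<in>players G. c i \<notin> set_pmf (\<sigma> i))"
  unfolding profile_eliminated_def using assms by (simp add: set_pmf_iff)

text \<open>A strategy that survives with positive weight extends to a profile that survives, by drawing
  the strategies of the opponents from any profile of the reduced game; this is where the reduced
  game must have a profile at all.\<close>

lemma strategy_eliminated_if_profiles_eliminated: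
  assumes fin: "finite (players \<Gamma>)" and ne: "profiles (mixed_game \<Gamma> S) \<noteq> {}"
    and sup: "\<And>j p. j \<in> players \<Gamma> \<Longrightarrow> p \<in> S j \<Longrightarrow> set_pmf p \<subseteq> strats \<Gamma> j"
    and i: "i \<in> players \<Gamma>"
    and elim: "\<And>c. c \<in> profiles \<Gamma> \<Longrightarrow> c i = a \<Longrightarrow> profile_eliminated (mixed_game \<Gamma> S) c"
  shows "strategy_eliminated (mixed_game \<Gamma> S) i a"
  unfolding strategy_eliminated_def
proof (rule ballI, rule ccontr)
  fix p assume p: "p \<in> strats (mixed_game \<Gamma> S) i" and "pmf p a \<noteq> 0"
  then have a: "a \<in> set_pmf p" by (simp add: set_pmf_iff)
  obtain \<tau> where \<tau>: "\<tau> \<in> profiles (mixed_game \<Gamma> S)" using ne by blast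
  define \<sigma> where "\<sigma> = \<tau>(i := p)"
  have \<sigma>: "\<sigma> \<in> profiles (mixed_game \<Gamma> S)"
    unfolding \<sigma>_def using \<tau> i p by (intro profiles_upd) auto
  define c where "c = (\<lambda>j\<in>players \<Gamma>. SOME x. x \<in> set_pmf (\<sigma> j))(i := a)"
  have c: "c j \<in> set_pmf (\<sigma> j)" if "j \<in> players \<Gamma>" for j
  proof (cases "j = i")
    case True
    then show ?thesis using a by (simp add: c_def \<sigma>_def)
  next
    case False
    then show ?thesis
      using that some_in_eq[of "set_pmf (\<sigma> j)"] set_pmf_not_empty[of "\<sigma> j"] by (simp add: c_def)
  qed
  have "c j \<in> strats \<Gamma> j" if "j \<in> players \<Gamma>" for j
    using c[OF that] sup[OF that, of "\<sigma> j"] profiles_strat[OF \<sigma>, of j] that by auto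
  then have "c \<in> profiles \<Gamma>"
    using i unfolding profiles_def by (intro PiE_I) (auto simp: c_def)
  then have "profile_eliminated (mixed_game \<Gamma> S) c" by (rule elim) (simp add: c_def)
  then show False using \<sigma> c fin by (auto simp: profile_eliminated_iff)
qed

theorem proposition14:
  fixes \<Gamma> :: "('i, 's) game"
  assumes "finite_game \<Gamma>"
  shows "(\<forall>c\<in>profiles \<Gamma>.
      (\<forall>\<mu>. correlated_equilibrium \<Gamma> \<mu> \<longrightarrow> pmf \<mu> c = 0) \<longrightarrow>
        (\<forall>\<alpha>. full_dual_vector \<Gamma> \<alpha> \<longrightarrow> profile_eliminated (dual_reduction \<Gamma> \<alpha>) c) \<and>
        (\<forall>G. iterative_dual_reduction \<Gamma> G \<and> elementary G \<longrightarrow> profile_eliminated G c))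
    \<and> (\<forall>i\<in>players \<Gamma>. \<forall>c\<^sub>i\<in>strats \<Gamma> i.
      (\<forall>\<mu>. correlated_equilibrium \<Gamma> \<mu> \<longrightarrow> pmf (marginal \<mu> i) c\<^sub>i = 0) \<longrightarrow>
        (\<forall>\<alpha>. full_dual_vector \<Gamma> \<alpha> \<longrightarrow> strategy_eliminated (dual_reduction \<Gamma> \<alpha>) i c\<^sub>i) \<and>
        (\<forall>G. iterative_dual_reduction \<Gamma> G \<and> elementary G \<longrightarrow> strategy_eliminated G i c\<^sub>i))"
proof -
  have fin: "finite_actions \<Gamma>" using assms unfolding finite_game_def finite_actions_def by blast
  have finp: "finite (players \<Gamma>)" by (rule finite_actionsD(1)[OF fin])
  have full: "profile_eliminated (dual_reduction \<Gamma> \<alpha>) c"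
    if c: "c \<in> profiles \<Gamma>" and zero: "\<And>\<mu>. correlated_equilibrium \<Gamma> \<mu> \<Longrightarrow> pmf \<mu> c = 0"
      and \<alpha>: "full_dual_vector \<Gamma> \<alpha>" for c \<alpha>
  proof -
    obtain \<beta> where "dual_vector \<Gamma> \<beta>" "0 < plan_gain \<Gamma> \<beta> c"
      using ex_strict_dual_vector[OF fin c zero] by blast
    from full_dual_reduction_eliminates[OF fin \<alpha> c this]
    show ?thesis using finp by (simp add: profile_eliminated_iff dual_reduction_def set_pmf_iff)
  qed
  have elem: "profile_eliminated G c"
    if c: "c \<in> profiles \<Gamma>" and zero: "\<And>\<mu>. correlated_equilibrium \<Gamma> \<mu> \<Longrightarrow> pmf \<mu> c = 0"
      and G: "iterative_dual_reduction \<Gamma> G" "elementary G" for c G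
  proof -
    have plG: "players G = players \<Gamma>"
      using iterative_dual_reduction_mixed_game[OF G(1)] by (metis mixed_game_simps(1))
    obtain \<nu> where \<nu>: "correlated_equilibrium G \<nu>" "\<And>\<sigma>. \<sigma> \<in> profiles G \<Longrightarrow> \<sigma> \<in> set_pmf \<nu>"
      using G(2) unfolding elementary_def strict_correlated_equilibrium_def
      by (metis pmf_positive_iff)
    obtain \<mu> where \<mu>: "correlated_equilibrium \<Gamma> \<mu>" "\<forall>c\<in>profiles \<Gamma>. \<forall>\<sigma>\<in>set_pmf \<nu>.
        (\<forall>i\<in>players \<Gamma>. c i \<in> set_pmf (\<sigma> i)) \<longrightarrow> c \<in> set_pmf \<mu>"
      using correlated_equilibrium_iterative[OF assms G(1) \<nu>(1)] by blast
    have "c \<notin> set_pmf \<mu>" using zero[OF \<mu>(1)] by (simp add: set_pmf_iff)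
    then show ?thesis using \<mu>(2) \<nu>(2) c finp plG by (auto simp: profile_eliminated_iff)
  qed
  have prof: "pmf \<mu> c = 0" if "pmf (marginal \<mu> i) (c i) = 0" for \<mu> i and c :: "'i \<Rightarrow> 's"
  proof (rule ccontr)
    assume "pmf \<mu> c \<noteq> 0"
    then have "c i \<in> set_pmf (marginal \<mu> i)" unfolding marginal_def by (auto simp: set_pmf_iff)
    then show False using that by (simp add: set_pmf_iff)
  qed
  have strategy_full: "strategy_eliminated (dual_reduction \<Gamma> \<alpha>) i a"
    if i: "i \<in> players \<Gamma>"
      and zero: "\<And>\<mu>. correlated_equilibrium \<Gamma> \<mu> \<Longrightarrow> pmf (marginal \<mu> i) a = 0"
      and \<alpha>: "full_dual_vector \<Gamma> \<alpha>" for i a \<alpha>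
    unfolding dual_reduction_def
  proof (rule strategy_eliminated_if_profiles_eliminated[OF finp _ reduced_strats_support i])
    have "reduced_strats (strats \<Gamma> j) (\<alpha> j) \<noteq> {}" if j: "j \<in> players \<Gamma>" for j
    proof -
      have "absorbing (strats \<Gamma> j) (\<alpha> j) (strats \<Gamma> j)"
        using \<alpha> assms j
        unfolding full_dual_vector_def dual_vector_def deviation_plan_def absorbing_def finite_game_def
        by blast
      then show ?thesis using reduced_strats_nonempty[OF finite_actionsD(2)[OF fin j]] by blast
    qed
    then show "profiles (mixed_game \<Gamma> (\<lambda>i. reduced_strats (strats \<Gamma> i) (\<alpha> i))) \<noteq> {}"
      unfolding profiles_mixed_game by (simp add: PiE_eq_empty_iff)
    show "profile_eliminated (mixed_game \<Gamma> (\<lambda>i. reduced_strats (strats \<Gamma> i) (\<alpha> i))) c"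
      if "c \<in> profiles \<Gamma>" "c i = a" for c
      using full[OF that(1) _ \<alpha>] prof[of _ i c] zero that(2) unfolding dual_reduction_def by simp
  qed
  have strategy_elem: "strategy_eliminated G i a"
    if i: "i \<in> players \<Gamma>"
      and zero: "\<And>\<mu>. correlated_equilibrium \<Gamma> \<mu> \<Longrightarrow> pmf (marginal \<mu> i) a = 0"
      and G: "iterative_dual_reduction \<Gamma> G" "elementary G" for i a G
  proof -
    have Geq: "mixed_game \<Gamma> (strats G) = G"
      by (rule iterative_dual_reduction_mixed_game[OF G(1), symmetric])
    have "strategy_eliminated (mixed_game \<Gamma> (strats G)) i a"
    proof (rule strategy_eliminated_if_profiles_eliminated[OF finp _ _ i])
      obtain \<nu> where "strict_correlated_equilibrium G \<nu>" using G(2) unfolding elementary_def by blast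
      then have "set_pmf \<nu> \<subseteq> profiles G"
        unfolding strict_correlated_equilibrium_def correlated_equilibrium_def by (elim conjE)
      then show "profiles (mixed_game \<Gamma> (strats G)) \<noteq> {}"
        unfolding Geq using set_pmf_not_empty[of \<nu>] by blast
      show "set_pmf p \<subseteq> strats \<Gamma> j" if "j \<in> players \<Gamma>" "p \<in> strats G j" for j p
        using iterative_dual_reduction_strats[OF assms G(1) that(1)] that(2) by blast
      show "profile_eliminated (mixed_game \<Gamma> (strats G)) c" if "c \<in> profiles \<Gamma>" "c i = a" for c
        unfolding Geq using elem[OF that(1) _ G] prof[of _ i c] zero that(2) by simp
    qed
    then show ?thesis unfolding Geq .
  qed
  show ?thesis using full elem strategy_full strategy_elem by (intro conjI ballI impI allI) auto
qed

end
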